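(* Let $\mathbb{D}=\{z\in\mathbb{C}:|z|<1\}$. For every domain $\Omega\subset\overline{\mathbb{C}}$ that omits a nonempty open set (i.e., $\overline{\mathbb{C}}\setminus\Omega$ contains a nonempty open subset of $\overline{\mathbb{C}}$) we have $$\sigma_H(\Omega)\le \sigma_H(\mathbb{D})\le \tfrac{3}{2},$$ where $\sigma_H$ denotes the harmonic inner radius.
   Context: A domain $\Omega\subset\overline{\mathbb{C}}=\mathbb{C}\cup\{\infty\}$ is hyperbolic if it has at least three boundary points. The density $\lambda_\Omega$ of its hyperbolic metric is defined by $\lambda_\Omega(\pi(z))\,|\pi'(z)|=\frac{1}{1-|z|^2}$, $z\in\mathbb{D}$, where $\pi:\mathbb{D}\to\Omega$ is any universal (holomorphic) covering map; this is independent of the choice of $\pi$. In particular $\lambda_{\mathbb{D}}(z)=\frac{1}{1-|z|^2}$. A harmonic mapping in $\Omega$ is a complex-valued (finite) harmonic function $f$ on $\Omega$. It is locally univalent if and only if its Jacobian $J_f=|f_z|^2-|f_{\overline z}|^2$ does not vanish (Lewy's theorem). For a locally univalent harmonic mapping $f$, the pre-Schwarzian and Schwarzian derivatives are $$P_f=(\log |J_f|)_z,\qquad S_f=(P_f)_z-\tfrac12 (P_f)^2,$$ where subscripts $z$ and $\overline z$ denote Wirtinger derivatives. The Schwarzian norm is $$\|S_f\|_\Omega=\sup_{z\in\Omega}\frac{|S_f(z)|}{\lambda_\Omega(z)^2}.$$ If $\infty\in\Omega$, harmonicity and local univalence at $\infty$ are understood in the local coordinate $\zeta=1/z$, and the supremum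 may be taken over $\Omega\setminus\{\infty\}$. The harmonic inner radius of a hyperbolic domain $\Omega$ is $$\sigma_H(\Omega)=\sup\{c\ge 0:\ \text{every locally univalent harmonic mapping } f \text{ in } \Omega \text{ with } \|S_f\|_\Omega\le c \text{ is injective}\}.$$ This constant is invariant under Möbius transformations of $\Omega$. *)

theory Defs
  imports "HOL-Complex_Analysis.Complex_Analysis"
begin

text \<open>The Riemann sphere. Its topology is glued from the two standard charts: the inclusion
  of the plane and the reciprocal chart \<open>\<zeta> = 1/z\<close>, which is centred at infinity.\<close>

datatype sphere = Fin complex | Infty

definition recip_chart :: "complex \<Rightarrow> sphere" where
  "recip_chart \<zeta> = (if \<zeta> = 0 then Infty else Fin (1 / \<zeta>))"

instantiation sphere :: topological_space
begin

definition open_sphere :: "sphere set \<Rightarrow> bool" where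
  "open_sphere S \<longleftrightarrow> open (Fin -` S) \<and> open (recip_chart -` S)"

instance
proof
  show "open (UNIV :: sphere set)"
    by (simp add: open_sphere_def)
  show "open (S \<inter> T)" if "open S" "open T" for S T :: "sphere set"
    using that by (auto simp: open_sphere_def vimage_Int)
  show "open (\<Union>K)" if "\<forall>S\<in>K. open S" for K :: "sphere set set"
    using that by (auto simp: open_sphere_def vimage_Union)
qed

end

text \<open>Affine coordinates of points of the sphere. The values \<open>fin_coord Infty\<close> and
  \<open>recip_coord (Fin 0)\<close> are meaningless and never used.\<close>

fun fin_coord :: "sphere \<Rightarrow> complex" where
  "fin_coord (Fin z) = z"
| "fin_coord Infty = 0"

fun recip_coord :: "sphere \<Rightarrow> complex" where
  "recip_coord (Fin z) = 1 / z"
| "recip_coord Infty = 0"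

definition sphere_domain :: "sphere set \<Rightarrow> bool" where
  "sphere_domain \<Omega> \<longleftrightarrow> open \<Omega> \<and> connected \<Omega> \<and> \<Omega> \<noteq> {}"

text \<open>Holomorphic maps from an open subset of the plane into the sphere.\<close>

definition sphere_holomorphic_on :: "(complex \<Rightarrow> sphere) \<Rightarrow> complex set \<Rightarrow> bool" where
  "sphere_holomorphic_on p U \<longleftrightarrow>
     continuous_on U p \<and>
     (fin_coord \<circ> p) holomorphic_on {z \<in> U. p z \<noteq> Infty} \<and>
     (recip_coord \<circ> p) holomorphic_on {z \<in> U. p z \<noteq> Fin 0}"

text \<open>The unit disc is simply connected, so every covering by it is universal.\<close>

definition universal_covering :: "(complex \<Rightarrow> sphere) \<Rightarrow> sphere set \<Rightarrow> bool" where
  "universal_covering p \<Omega> \<longleftrightarrow>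
     sphere_holomorphic_on p (ball 0 1) \<and> covering_space (ball 0 1) p \<Omega>"

text \<open>The density of the hyperbolic metric at a finite point \<open>w\<close> of a hyperbolic domain \<open>\<Omega>\<close>
  (a domain with at least three boundary points, so in particular any domain omitting a nonempty
  open set). By \<open>\<lambda>(\<pi>(z)) |\<pi>'(z)| = 1 / (1 - |z|\<^sup>2)\<close>, each universal covering \<open>\<pi>\<close> and each \<open>z\<close>
  with \<open>\<pi>(z) = w\<close> determine the value \<open>1 / ((1 - |z|\<^sup>2) |\<pi>'(z)|)\<close>. A universal covering exists by
  the uniformization theorem, and the value does not depend on \<open>\<pi>\<close> and \<open>z\<close>; hence the set
  below is a singleton, and \<open>Inf\<close> merely extracts its element.\<close>

definition hyperbolic_density :: "sphere set \<Rightarrow> complex \<Rightarrow> ennreal" where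
  "hyperbolic_density \<Omega> w =
     Inf {ennreal (1 / ((1 - (cmod z)\<^sup>2) * cmod (deriv (fin_coord \<circ> p) z))) | p z.
            universal_covering p \<Omega> \<and> z \<in> ball 0 1 \<and> p z = Fin w}"

text \<open>Real partial derivatives, Wirtinger derivatives, and harmonic functions on open subsets
  of the plane (of class \<open>C\<^sup>2\<close> with vanishing Laplacian).\<close>

definition partial_x :: "(complex \<Rightarrow> complex) \<Rightarrow> complex \<Rightarrow> complex" where
  "partial_x f z = frechet_derivative f (at z) 1"

definition partial_y :: "(complex \<Rightarrow> complex) \<Rightarrow> complex \<Rightarrow> complex" where
  "partial_y f z = frechet_derivative f (at z) \<i>"

definition wirtinger :: "(complex \<Rightarrow> complex) \<Rightarrow> complex \<Rightarrow> complex" where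
  "wirtinger f z = (partial_x f z - \<i> * partial_y f z) / 2"

definition wirtinger_bar :: "(complex \<Rightarrow> complex) \<Rightarrow> complex \<Rightarrow> complex" where
  "wirtinger_bar f z = (partial_x f z + \<i> * partial_y f z) / 2"

definition C1_on :: "(complex \<Rightarrow> complex) \<Rightarrow> complex set \<Rightarrow> bool" where
  "C1_on f U \<longleftrightarrow>
     f differentiable_on U \<and> continuous_on U (partial_x f) \<and> continuous_on U (partial_y f)"

definition harmonic_on :: "(complex \<Rightarrow> complex) \<Rightarrow> complex set \<Rightarrow> bool" where
  "harmonic_on f U \<longleftrightarrow>
     C1_on f U \<and> C1_on (partial_x f) U \<and> C1_on (partial_y f) U \<and>
     (\<forall>z\<in>U. partial_x (partial_x f) z + partial_y (partial_y f) z = 0)"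

definition harmonic_mapping :: "(sphere \<Rightarrow> complex) \<Rightarrow> sphere set \<Rightarrow> bool" where
  "harmonic_mapping f \<Omega> \<longleftrightarrow>
     harmonic_on (f \<circ> Fin) (Fin -` \<Omega>) \<and> harmonic_on (f \<circ> recip_chart) (recip_chart -` \<Omega>)"

definition locally_univalent :: "(sphere \<Rightarrow> complex) \<Rightarrow> sphere set \<Rightarrow> bool" where
  "locally_univalent f \<Omega> \<longleftrightarrow> (\<forall>p\<in>\<Omega>. \<exists>V. open V \<and> p \<in> V \<and> inj_on f (V \<inter> \<Omega>))"

definition jacobian :: "(complex \<Rightarrow> complex) \<Rightarrow> complex \<Rightarrow> real" where
  "jacobian f z = (cmod (wirtinger f z))\<^sup>2 - (cmod (wirtinger_bar f z))\<^sup>2"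

definition pre_schwarzian :: "(complex \<Rightarrow> complex) \<Rightarrow> complex \<Rightarrow> complex" where
  "pre_schwarzian f = wirtinger (\<lambda>z. complex_of_real (ln \<bar>jacobian f z\<bar>))"

definition schwarzian :: "(complex \<Rightarrow> complex) \<Rightarrow> complex \<Rightarrow> complex" where
  "schwarzian f z = wirtinger (pre_schwarzian f) z - (pre_schwarzian f z)\<^sup>2 / 2"

text \<open>The supremum is taken over the finite points of \<open>\<Omega>\<close> only.\<close>

definition schwarzian_norm :: "sphere set \<Rightarrow> (sphere \<Rightarrow> complex) \<Rightarrow> ennreal" where
  "schwarzian_norm \<Omega> f =
     (SUP z \<in> Fin -` \<Omega>. ennreal (cmod (schwarzian (f \<circ> Fin) z)) / (hyperbolic_density \<Omega> z)\<^sup>2)"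

definition harmonic_inner_radius :: "sphere set \<Rightarrow> ennreal" where
  "harmonic_inner_radius \<Omega> =
     Sup {ennreal c | c. 0 \<le> c \<and>
            (\<forall>f. harmonic_mapping f \<Omega> \<longrightarrow> locally_univalent f \<Omega> \<longrightarrow>
                 schwarzian_norm \<Omega> f \<le> ennreal c \<longrightarrow> inj_on f \<Omega>)}"

end

theory Submission
  imports Defs
begin

text \<open>Both inequalities are about producing noninjective maps with small Schwarzian norm.

  For the comparison with the disc, let \<open>c\<close> be too large for the disc: some locally univalent
  harmonic \<open>f\<close> with Schwarzian norm at most \<open>c\<close> takes the same value at two points. Enlarge a disc in the
  complement of \<open>\<Omega>\<close> until it touches \<open>\<Omega>\<close>. Its complement is, up to a Moebius map \<open>T\<close>, the unit
  disc; so \<open>T\<close> maps \<open>\<Omega>\<close> to a connected subset of the unit disc that accumulates at the unit circle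
  (\<open>exists_inversion_touching_circle\<close>). Such a set contains two points at every prescribed hyperbolic
  distance (\<open>pseudohyperbolic_distance_attained\<close>), hence after an automorphism of the disc the two points
  are in \<open>T\<close>'s image of \<open>\<Omega>\<close>. The pullback of \<open>f\<close> to \<open>\<Omega>\<close> is then noninjective, and its Schwarzian norm
  is at most \<open>c\<close>: the Schwarzian is Moebius covariant (\<open>schwarzian_comp_mobius\<close>), and by the Schwarz--Pick
  lemma the hyperbolic density of \<open>\<Omega>\<close> is at least that of the larger disc (\<open>hyperbolic_density_ge\<close>).
  The covariance requires a nonvanishing Jacobian, which local univalence gives by \<open>Lewy\<close>'s theorem.

  For the bound \<open>3 / 2\<close> it suffices to exhibit noninjective maps of a half-plane whose norm is arbitrarily
  close to \<open>3 / 2\<close>. The map \<open>x + 2 \<i> x y\<close> of the right half-plane has a Jacobian proportional to the distance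
  from the boundary, which gives the norm \<open>3 / 2\<close> exactly. It is injective, but only just:
  it sends the entire boundary line to \<open>0\<close>. Replacing its components, the real part of \<open>s\<close> and the imaginary
  part of \<open>s\<^sup>2\<close>, by those of \<open>s powr (1 + m)\<close> and \<open>s powr (2 + m)\<close> destroys injectivity for every \<open>m > 0\<close>, while the
  norm is at most \<open>3 / 2 + 6 * m + 2 * m\<^sup>2\<close> (\<open>wedge_map_facts\<close>, \<open>wedge_map_not_injective\<close>).\<close>

section \<open>Wirtinger calculus\<close>

text \<open>The real derivative in the coordinates \<open>v\<close> and \<open>cnj v\<close>. In contrast to \<^const>\<open>wirtinger\<close> and
  \<^const>\<open>wirtinger_bar\<close>, which are total, the predicate asserts differentiability; this is what the
  sum, product and chain rules need.\<close>

definition has_wirtinger ::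
  "(complex \<Rightarrow> complex) \<Rightarrow> complex \<Rightarrow> complex \<Rightarrow> complex \<Rightarrow> bool" where
  "has_wirtinger f A B z \<longleftrightarrow> (f has_derivative (\<lambda>v. A * v + B * cnj v)) (at z)"

lemma has_wirtinger_differentiable: "has_wirtinger f A B z \<Longrightarrow> f differentiable (at z)"
  unfolding has_wirtinger_def differentiable_def by blast

lemma has_wirtinger_partial:
  assumes "has_wirtinger f A B z"
  shows "partial_x f z = A + B" and "partial_y f z = \<i> * (A - B)"
proof -
  have "frechet_derivative f (at z) = (\<lambda>v. A * v + B * cnj v)"
    using assms unfolding has_wirtinger_def by (rule frechet_derivative_at[symmetric])
  then show "partial_x f z = A + B" and "partial_y f z = \<i> * (A - B)"
    by (simp_all add: partial_x_def partial_y_def algebra_simps)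
qed

lemma has_wirtinger_imp_wirtinger:
  assumes "has_wirtinger f A B z"
  shows "wirtinger f z = A" and "wirtinger_bar f z = B"
  unfolding wirtinger_def wirtinger_bar_def has_wirtinger_partial[OF assms] by simp_all

lemma differentiable_imp_has_wirtinger:
  assumes "f differentiable (at z)"
  shows "has_wirtinger f (wirtinger f z) (wirtinger_bar f z) z"
proof -
  define D where "D = frechet_derivative f (at z)"
  have D: "(f has_derivative D) (at z)"
    using assms unfolding D_def by (simp add: frechet_derivative_works)
  interpret D: linear D by (rule has_derivative_linear[OF D])
  have "D v = wirtinger f z * v + wirtinger_bar f z * cnj v" for v
  proof -
    have "D v = D (Re v *\<^sub>R 1 + Im v *\<^sub>R \<i>)"
      by (rule arg_cong[where f = D]) (simp add: complex_eq_iff)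
    also have "\<dots> = Re v *\<^sub>R D 1 + Im v *\<^sub>R D \<i>"
      by (simp only: D.add D.scaleR)
    also have "\<dots> = wirtinger f z * v + wirtinger_bar f z * cnj v"
      unfolding wirtinger_def wirtinger_bar_def partial_x_def partial_y_def D_def[symmetric]
      by (simp add: complex_eq_iff field_simps)
    finally show ?thesis .
  qed
  then have "D = (\<lambda>v. wirtinger f z * v + wirtinger_bar f z * cnj v)" by (rule ext)
  with D show ?thesis unfolding has_wirtinger_def by simp
qed

lemma has_wirtinger_cong:
  assumes "has_wirtinger f A B z" "open U" "z \<in> U" "\<And>w. w \<in> U \<Longrightarrow> f w = g w"
  shows "has_wirtinger g A B z"
  using has_derivative_transform_within_open[OF assms(1)[unfolded has_wirtinger_def] assms(2-4)]
  unfolding has_wirtinger_def .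

lemma wirtinger_cong:
  assumes "open U" "z \<in> U" "\<And>w. w \<in> U \<Longrightarrow> f w = g w"
  shows "wirtinger f z = wirtinger g z"
proof -
  have "(f has_derivative D) (at z) \<longleftrightarrow> (g has_derivative D) (at z)" for D
    using has_derivative_transform_within_open[OF _ assms(1,2), of f D UNIV g]
      has_derivative_transform_within_open[OF _ assms(1,2), of g D UNIV f] assms(3) by auto
  then have "frechet_derivative f (at z) = frechet_derivative g (at z)"
    by (simp add: frechet_derivative_def)
  then show ?thesis by (simp add: wirtinger_def partial_x_def partial_y_def)
qed

lemma has_wirtinger_holomorphic:
  "(f has_field_derivative A) (at z) \<Longrightarrow> has_wirtinger f A 0 z"
  unfolding has_wirtinger_def has_field_derivative_def by simp

lemma has_wirtinger_0_imp_field_differentiable: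
  "has_wirtinger f A 0 z \<Longrightarrow> f field_differentiable (at z)"
  unfolding has_wirtinger_def field_differentiable_def has_field_derivative_def by auto

lemma has_wirtinger_cnj:
  "has_wirtinger f A B z \<Longrightarrow> has_wirtinger (\<lambda>w. cnj (f w)) (cnj B) (cnj A) z"
  unfolding has_wirtinger_def by (drule has_derivative_cnj) (simp add: add.commute)

lemma has_wirtinger_add:
  "has_wirtinger f A B z \<Longrightarrow> has_wirtinger g A' B' z \<Longrightarrow>
   has_wirtinger (\<lambda>w. f w + g w) (A + A') (B + B') z"
  unfolding has_wirtinger_def by (drule (1) has_derivative_add) (simp add: algebra_simps)

lemma has_wirtinger_diff:
  "has_wirtinger f A B z \<Longrightarrow> has_wirtinger g A' B' z \<Longrightarrow>
   has_wirtinger (\<lambda>w. f w - g w) (A - A') (B - B') z"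
  unfolding has_wirtinger_def by (drule (1) has_derivative_diff) (simp add: algebra_simps)

lemma has_wirtinger_mult:
  "has_wirtinger f A B z \<Longrightarrow> has_wirtinger g A' B' z \<Longrightarrow>
   has_wirtinger (\<lambda>w. f w * g w) (f z * A' + A * g z) (f z * B' + B * g z) z"
  unfolding has_wirtinger_def by (drule (1) has_derivative_mult) (simp add: algebra_simps)

lemma has_wirtinger_inverse:
  assumes "has_wirtinger f A B z" "f z \<noteq> 0"
  shows "has_wirtinger (\<lambda>w. inverse (f w)) (- A / (f z)\<^sup>2) (- B / (f z)\<^sup>2) z"
proof -
  have "(inverse has_derivative (\<lambda>h. - (inverse (f z) * h * inverse (f z)))) (at (f z))"
    using assms(2) by (rule has_derivative_inverse')
  with assms(1) have "((\<lambda>w. inverse (f w)) has_derivative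
      (\<lambda>v. - (inverse (f z) * (A * v + B * cnj v) * inverse (f z)))) (at z)"
    unfolding has_wirtinger_def by (rule has_derivative_compose[of f _ z UNIV inverse])
  then show ?thesis
    unfolding has_wirtinger_def by (simp add: field_simps power2_eq_square add_divide_distrib)
qed

lemma has_wirtinger_comp_holomorphic:
  assumes "has_wirtinger f A B (T z)" "(T has_field_derivative D) (at z)"
  shows "has_wirtinger (\<lambda>w. f (T w)) (A * D) (B * cnj D) z"
proof -
  have "((\<lambda>w. f (T w)) has_derivative (\<lambda>v. A * (D * v) + B * cnj (D * v))) (at z)"
    using assms unfolding has_wirtinger_def has_field_derivative_def
    by (rule_tac has_derivative_compose[of T _ z UNIV f])
  then show ?thesis unfolding has_wirtinger_def by (simp add: mult.assoc)
qed

lemma has_wirtinger_ln_abs: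
  fixes J :: "complex \<Rightarrow> real"
  assumes "has_wirtinger (\<lambda>w. of_real (J w)) A B z" "J z \<noteq> 0"
  shows "has_wirtinger (\<lambda>w. of_real (ln \<bar>J w\<bar>)) (A / J z) (B / J z) z"
proof -
  have "((\<lambda>w. Re (of_real (J w))) has_derivative (\<lambda>v. Re (A * v + B * cnj v))) (at z)"
    using assms(1) unfolding has_wirtinger_def by (rule has_derivative_Re)
  then have J: "(J has_derivative (\<lambda>v. Re (A * v + B * cnj v))) (at z)" by simp
  have real: "A * v + B * cnj v = of_real (Re (A * v + B * cnj v))" for v
  proof -
    have "((\<lambda>w. of_real (J w)::complex) has_derivative (\<lambda>v. of_real (Re (A * v + B * cnj v)))) (at z)"
      using J by (rule has_derivative_of_real)
    from has_derivative_unique[OF this assms(1)[unfolded has_wirtinger_def]]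
    show ?thesis by metis
  qed
  have "((\<lambda>x::real. ln \<bar>x\<bar>) has_field_derivative (1 / J z)) (at (J z))"
  proof (cases "J z > 0")
    case True
    have "(ln has_field_derivative (1 / J z)) (at (J z))"
      using True by (auto intro!: derivative_eq_intros)
    moreover have "\<forall>\<^sub>F x in nhds (J z). ln \<bar>x\<bar> = ln x"
      using True by (auto simp: eventually_nhds intro!: exI[of _ "{0<..}"])
    ultimately show ?thesis
      using True by (subst DERIV_cong_ev[OF refl _ refl, of _ ln]) auto
  next
    case False
    with assms(2) have neg: "J z < 0" by simp
    have "((\<lambda>x. ln (- x)) has_field_derivative (1 / J z)) (at (J z))"
      using neg by (auto intro!: derivative_eq_intros simp: field_simps)
    moreover have "\<forall>\<^sub>F x in nhds (J z). ln \<bar>x\<bar> = ln (- x)"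
      using neg by (auto simp: eventually_nhds intro!: exI[of _ "{..<0}"])
    ultimately show ?thesis
      using neg by (subst DERIV_cong_ev[OF refl _ refl, of _ "\<lambda>x. ln (- x)"]) auto
  qed
  then have "((\<lambda>x::real. ln \<bar>x\<bar>) has_derivative (\<lambda>h. 1 / J z * h)) (at (J z))"
    unfolding has_field_derivative_def .
  from has_derivative_of_real[OF has_derivative_compose[OF J this]]
  have "((\<lambda>w. of_real (ln \<bar>J w\<bar>)) has_derivative
      (\<lambda>v. of_real (1 / J z * Re (A * v + B * cnj v)) :: complex)) (at z)" .
  moreover have "of_real (1 / J z * Re (A * v + B * cnj v)) = A / J z * v + B / J z * cnj v" for v
  proof -
    have "of_real (1 / J z * Re (A * v + B * cnj v)) = (A * v + B * cnj v) / J z"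
      using real[of v] by simp
    then show ?thesis by (simp add: add_divide_distrib)
  qed
  ultimately show ?thesis unfolding has_wirtinger_def by simp
qed

section \<open>Harmonic functions as pairs of holomorphic functions\<close>

text \<open>Locally \<open>f = h + cnj g\<close> with \<open>h\<close> and \<open>g\<close> holomorphic. Recording only the derivatives \<open>a = h'\<close> and
  \<open>b = g'\<close> gives an object that exists globally on every open set, simply connected or not.\<close>

definition harmonic_form ::
  "(complex \<Rightarrow> complex) \<Rightarrow> (complex \<Rightarrow> complex) \<Rightarrow> (complex \<Rightarrow> complex) \<Rightarrow> complex set \<Rightarrow> bool" where
  "harmonic_form f a b U \<longleftrightarrow> a holomorphic_on U \<and> b holomorphic_on U \<and>
     (\<forall>z\<in>U. has_wirtinger f (a z) (cnj (b z)) z)"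

text \<open>The class of functions with a holomorphic pair is closed under taking partial derivatives; the
  second order conditions in \<^const>\<open>harmonic_on\<close> thereby reduce to first order ones.\<close>

lemma harmonic_form_partials:
  assumes "open U" "harmonic_form f a b U"
  shows "z \<in> U \<Longrightarrow> partial_x f z = a z + cnj (b z)"
    and "z \<in> U \<Longrightarrow> partial_y f z = \<i> * a z + cnj (\<i> * b z)"
    and "harmonic_form (partial_x f) (deriv a) (deriv b) U"
    and "harmonic_form (partial_y f) (\<lambda>z. \<i> * deriv a z) (\<lambda>z. \<i> * deriv b z) U"
proof -
  have hol: "a holomorphic_on U" "b holomorphic_on U"
    and w: "\<And>z. z \<in> U \<Longrightarrow> has_wirtinger f (a z) (cnj (b z)) z"
    using assms unfolding harmonic_form_def by auto
  show px: "partial_x f z = a z + cnj (b z)" if "z \<in> U" for z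
    using has_wirtinger_partial[OF w[OF that]] by simp
  show py: "partial_y f z = \<i> * a z + cnj (\<i> * b z)" if "z \<in> U" for z
    using has_wirtinger_partial[OF w[OF that]] by (simp add: algebra_simps)
  have sum: "has_wirtinger (\<lambda>w. p w + cnj (q w)) p' (cnj q') z"
    if "(p has_field_derivative p') (at z)" "(q has_field_derivative q') (at z)" for p q p' q' z
    using has_wirtinger_add[OF has_wirtinger_holomorphic[OF that(1)]
        has_wirtinger_cnj[OF has_wirtinger_holomorphic[OF that(2)]]] by simp
  have da: "(a has_field_derivative deriv a z) (at z)" "(b has_field_derivative deriv b z) (at z)"
    if "z \<in> U" for z
    using hol that assms(1) by (auto intro: holomorphic_derivI)
  show "harmonic_form (partial_x f) (deriv a) (deriv b) U"
    unfolding harmonic_form_def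
    using hol assms(1) has_wirtinger_cong[OF sum[OF da] assms(1) _ px[symmetric]]
    by (auto intro: holomorphic_deriv)
  show "harmonic_form (partial_y f) (\<lambda>z. \<i> * deriv a z) (\<lambda>z. \<i> * deriv b z) U"
    unfolding harmonic_form_def
    using hol assms(1) has_wirtinger_cong[OF sum[OF DERIV_cmult[OF da(1)] DERIV_cmult[OF da(2)]]
          assms(1) _ py[symmetric]]
    by (auto intro!: holomorphic_deriv holomorphic_intros)
qed

lemma harmonic_form_C1:
  assumes "open U" "harmonic_form f a b U"
  shows "C1_on f U"
proof -
  have hol: "continuous_on U a" "continuous_on U b"
    using assms unfolding harmonic_form_def by (auto intro: holomorphic_on_imp_continuous_on)
  have "f differentiable_on U"
    using assms unfolding harmonic_form_def
    by (meson differentiable_at_imp_differentiable_on has_wirtinger_differentiable)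
  moreover have "continuous_on U (partial_x f)"
    using hol by (subst continuous_on_cong[OF refl harmonic_form_partials(1)[OF assms]])
      (auto intro!: continuous_intros)
  moreover have "continuous_on U (partial_y f)"
    using hol by (subst continuous_on_cong[OF refl harmonic_form_partials(2)[OF assms]])
      (auto intro!: continuous_intros)
  ultimately show ?thesis by (simp add: C1_on_def)
qed

lemma harmonic_form_imp_harmonic_on:
  assumes "open U" "harmonic_form f a b U"
  shows "harmonic_on f U"
proof -
  note p = harmonic_form_partials[OF assms]
  have "partial_x (partial_x f) z + partial_y (partial_y f) z = 0" if "z \<in> U" for z
    using harmonic_form_partials(1)[OF assms(1) p(3) that]
      harmonic_form_partials(2)[OF assms(1) p(4) that]
    by simp
  then show ?thesis
    unfolding harmonic_on_def
    using harmonic_form_C1[OF assms] harmonic_form_C1[OF assms(1) p(3)]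
      harmonic_form_C1[OF assms(1) p(4)] by blast
qed

text \<open>Two applications of the mean value theorem turn a second difference over a square into a mixed
  derivative at some inner point. Differencing in either order gives the same quantity, and this is
  the reason for the symmetry of mixed partial derivatives below.\<close>

lemma second_difference_mvt:
  fixes F :: "real \<Rightarrow> real \<Rightarrow> real"
  assumes "h > 0"
    and s: "\<And>s t. 0 \<le> s \<Longrightarrow> s \<le> h \<Longrightarrow> 0 \<le> t \<Longrightarrow> t \<le> h \<Longrightarrow> ((\<lambda>s. F s t) has_real_derivative Fs s t) (at s)"
    and st: "\<And>s t. 0 \<le> s \<Longrightarrow> s \<le> h \<Longrightarrow> 0 \<le> t \<Longrightarrow> t \<le> h \<Longrightarrow> ((\<lambda>t. Fs s t) has_real_derivative Fst s t) (at t)"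
  obtains s t where "0 < s" "s < h" "0 < t" "t < h"
    "F h h - F h 0 - F 0 h + F 0 0 = h * h * Fst s t"
proof -
  have "\<exists>s. 0 < s \<and> s < h \<and> (F h h - F h 0) - (F 0 h - F 0 0) = (h - 0) * (Fs s h - Fs s 0)"
    using assms(1) by (intro MVT2[where f = "\<lambda>s. F s h - F s 0"] DERIV_diff s) auto
  then obtain s where s1: "0 < s" "s < h" "(F h h - F h 0) - (F 0 h - F 0 0) = h * (Fs s h - Fs s 0)"
    by auto
  have "\<exists>t. 0 < t \<and> t < h \<and> Fs s h - Fs s 0 = (h - 0) * Fst s t"
    using assms(1) s1 by (intro MVT2[where f = "\<lambda>t. Fs s t"] st) auto
  then obtain t where "0 < t" "t < h" "Fs s h - Fs s 0 = h * Fst s t" by auto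
  with s1 that show thesis by (simp add: algebra_simps)
qed

lemma C1_on_line_derivs:
  fixes L :: "complex \<Rightarrow> real"
  assumes "C1_on f U" "open U" "Complex s t \<in> U" and L: "bounded_linear L"
  shows "((\<lambda>s. L (f (Complex s t))) has_real_derivative L (partial_x f (Complex s t))) (at s)"
    and "((\<lambda>t. L (f (Complex s t))) has_real_derivative L (partial_y f (Complex s t))) (at t)"
proof -
  interpret L: bounded_linear L by fact
  define D where "D = frechet_derivative f (at (Complex s t))"
  have D: "(f has_derivative D) (at (Complex s t))"
    using assms unfolding D_def C1_on_def
    by (metis differentiable_on_eq_differentiable_at frechet_derivative_works)
  interpret D: linear D by (rule has_derivative_linear[OF D])
  show "((\<lambda>s. L (f (Complex s t))) has_real_derivative L (partial_x f (Complex s t))) (at s)"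
  proof -
    have "((\<lambda>s. of_real s + \<i> * of_real t) has_derivative (\<lambda>h. of_real h)) (at s)"
      by (auto intro!: derivative_eq_intros)
    then have "((\<lambda>s. Complex s t) has_derivative (\<lambda>h. of_real h)) (at s)"
      by (simp add: Complex_eq)
    from has_derivative_compose[OF has_derivative_compose[OF this D] L.has_derivative[OF has_derivative_ident]]
    have "((\<lambda>s. L (f (Complex s t))) has_derivative (\<lambda>h. L (D (of_real h)))) (at s)" .
    moreover have "L (D (of_real h)) = L (partial_x f (Complex s t)) * h" for h
      using D.scaleR[of h 1] L.scaleR
      by (simp add: partial_x_def D_def[symmetric] scaleR_conv_of_real[symmetric] of_real_def)
    ultimately show ?thesis by (simp add: has_field_derivative_def)
  qed
  show "((\<lambda>t. L (f (Complex s t))) has_real_derivative L (partial_y f (Complex s t))) (at t)"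
  proof -
    have "((\<lambda>t. of_real s + \<i> * of_real t) has_derivative (\<lambda>h. h *\<^sub>R \<i>)) (at t)"
      by (auto intro!: derivative_eq_intros simp: scaleR_conv_of_real)
    then have "((\<lambda>t. Complex s t) has_derivative (\<lambda>h. h *\<^sub>R \<i>)) (at t)"
      by (simp add: Complex_eq)
    from has_derivative_compose[OF has_derivative_compose[OF this D] L.has_derivative[OF has_derivative_ident]]
    have "((\<lambda>t. L (f (Complex s t))) has_derivative (\<lambda>h. L (D (h *\<^sub>R \<i>)))) (at t)" .
    moreover have "L (D (h *\<^sub>R \<i>)) = L (partial_y f (Complex s t)) * h" for h
      by (simp only: D.scaleR L.scaleR partial_y_def D_def[symmetric]) simp
    ultimately show ?thesis by (simp add: has_field_derivative_def)
  qed
qed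

text \<open>The mean value theorem is about real-valued functions, so the symmetry is first shown after
  application of a real functional \<open>L\<close>; the real and the imaginary part are used afterwards.\<close>

lemma mixed_partials_functional:
  fixes L :: "complex \<Rightarrow> real"
  assumes "open U" "z \<in> U" "C1_on f U" "C1_on (partial_x f) U" "C1_on (partial_y f) U"
    and L: "bounded_linear L"
  shows "L (partial_y (partial_x f) z) = L (partial_x (partial_y f) z)"
proof -
  interpret L: bounded_linear L by fact
  define p where "p = (\<lambda>w. L (partial_y (partial_x f) w))"
  define q where "q = (\<lambda>w. L (partial_x (partial_y f) w))"
  have "continuous_on U p" "continuous_on U q"
    using assms(4,5) unfolding p_def q_def C1_on_def by (auto intro: L.continuous_on)
  then have cont: "isCont p z" "isCont q z"
    using assms(1,2) by (auto simp: continuous_on_eq_continuous_at)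
  have "dist (p z) (q z) \<le> e" if "e > 0" for e :: real
  proof -
    obtain d1 where d1: "d1 > 0" "\<And>w. dist w z < d1 \<Longrightarrow> dist (p w) (p z) < e / 2"
      using cont(1) \<open>e > 0\<close> unfolding continuous_at_eps_delta
      by (metis half_gt_zero)
    obtain d2 where d2: "d2 > 0" "\<And>w. dist w z < d2 \<Longrightarrow> dist (q w) (q z) < e / 2"
      using cont(2) \<open>e > 0\<close> unfolding continuous_at_eps_delta
      by (metis half_gt_zero)
    obtain d3 where d3: "d3 > 0" "ball z d3 \<subseteq> U"
      using assms(1,2) openE by blast
    \<comment> \<open>The square with corner \<open>z\<close> and side \<open>h\<close> stays within distance \<open>2 * h\<close> of \<open>z\<close>.\<close>
    define h where "h = min d1 (min d2 d3) / 3"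
    have h: "h > 0" "3 * h \<le> d1" "3 * h \<le> d2" "3 * h \<le> d3" using d1 d2 d3 by (auto simp: h_def)
    define W where "W = (\<lambda>s t. Complex (Re z + s) (Im z + t))"
    have near: "dist (W s t) z < 3 * h" if "0 \<le> s" "s \<le> h" "0 \<le> t" "t \<le> h" for s t
    proof -
      have "dist (W s t) z = cmod (Complex s t)"
        by (simp add: W_def dist_norm complex_diff minus_complex.ctr)
      also have "\<dots> \<le> \<bar>s\<bar> + \<bar>t\<bar>" using cmod_le[of "Complex s t"] by simp
      finally show ?thesis using that h by linarith
    qed
    have inU: "W s t \<in> U" if "0 \<le> s" "s \<le> h" "0 \<le> t" "t \<le> h" for s t
      using near[OF that] h d3 by (auto simp: subset_iff dist_commute)
    have ds: "((\<lambda>s. L (g (W s t))) has_real_derivative L (partial_x g (W s t))) (at s)"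
      if "C1_on g U" "W s t \<in> U" for g s t
      using C1_on_line_derivs(1)[OF that(1) assms(1) that(2)[unfolded W_def] L]
      unfolding W_def by (auto simp: DERIV_shift add.commute)
    have dt: "((\<lambda>t. L (g (W s t))) has_real_derivative L (partial_y g (W s t))) (at t)"
      if "C1_on g U" "W s t \<in> U" for g s t
      using C1_on_line_derivs(2)[OF that(1) assms(1) that(2)[unfolded W_def] L]
      unfolding W_def by (auto simp: DERIV_shift add.commute)
    obtain s1 t1 where 1: "0 < s1" "s1 < h" "0 < t1" "t1 < h"
      "L (f (W h h)) - L (f (W h 0)) - L (f (W 0 h)) + L (f (W 0 0)) = h * h * p (W s1 t1)"
      unfolding p_def
      by (rule second_difference_mvt[OF h(1), of "\<lambda>s t. L (f (W s t))" "\<lambda>s t. L (partial_x f (W s t))"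
            "\<lambda>s t. L (partial_y (partial_x f) (W s t))"])
        (auto intro!: ds dt assms inU)
    obtain t2 s2 where 2: "0 < t2" "t2 < h" "0 < s2" "s2 < h"
      "L (f (W h h)) - L (f (W 0 h)) - L (f (W h 0)) + L (f (W 0 0)) = h * h * q (W s2 t2)"
      unfolding q_def
      by (rule second_difference_mvt[OF h(1), of "\<lambda>t s. L (f (W s t))" "\<lambda>t s. L (partial_y f (W s t))"
            "\<lambda>t s. L (partial_x (partial_y f) (W s t))"])
        (auto intro!: ds dt assms inU)
    have "h * h * p (W s1 t1) = h * h * q (W s2 t2)" using 1(5) 2(5) by linarith
    then have eq: "p (W s1 t1) = q (W s2 t2)" using h by simp
    have "dist (W s1 t1) z < d1" "dist (W s2 t2) z < d2"
      using near[of s1 t1] near[of s2 t2] 1 2 h by auto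
    then have "dist (p (W s1 t1)) (p z) < e / 2" "dist (q (W s2 t2)) (q z) < e / 2"
      using d1(2) d2(2) by blast+
    with eq show ?thesis unfolding dist_real_def by linarith
  qed
  then have "dist (p z) (q z) \<le> 0" by (rule field_le_epsilon) simp
  then show ?thesis by (simp add: p_def q_def)
qed

lemma mixed_partials:
  assumes "open U" "z \<in> U" "C1_on f U" "C1_on (partial_x f) U" "C1_on (partial_y f) U"
  shows "partial_y (partial_x f) z = partial_x (partial_y f) z"
  using mixed_partials_functional[OF assms bounded_linear_Re]
    mixed_partials_functional[OF assms bounded_linear_Im] by (simp add: complex_eq_iff)

text \<open>Given the symmetry of the mixed partial derivatives, Laplace's equation for \<open>f\<close> is the
  Cauchy--Riemann equation for each of \<open>wirtinger f\<close> and \<open>cnj (wirtinger_bar f)\<close>.\<close>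

lemma harmonic_on_imp_harmonic_form:
  assumes "open U" "harmonic_on f U"
  obtains a b where "harmonic_form f a b U"
proof -
  have C1: "C1_on f U" "C1_on (partial_x f) U" "C1_on (partial_y f) U"
    and lap: "\<And>z. z \<in> U \<Longrightarrow> partial_x (partial_x f) z + partial_y (partial_y f) z = 0"
    using assms unfolding harmonic_on_def by auto
  have w: "has_wirtinger g (wirtinger g z) (wirtinger_bar g z) z" if "C1_on g U" "z \<in> U" for g z
    using that assms(1) unfolding C1_on_def
    by (intro differentiable_imp_has_wirtinger) (simp add: differentiable_on_eq_differentiable_at)
  have lin: "has_wirtinger (\<lambda>w. (partial_x f w + c * partial_y f w) / 2)
      ((wirtinger (partial_x f) z + c * wirtinger (partial_y f) z) / 2)
      ((wirtinger_bar (partial_x f) z + c * wirtinger_bar (partial_y f) z) / 2) z"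
    if "z \<in> U" for c z
    using has_derivative_mult_right[OF has_derivative_add[OF w[OF C1(2) that, unfolded has_wirtinger_def]
      has_derivative_mult_right[OF w[OF C1(3) that, unfolded has_wirtinger_def], of c]], of "1/2"]
    unfolding has_wirtinger_def by (simp add: algebra_simps add_divide_distrib)
  have hol: "(wirtinger f) holomorphic_on U"
  proof (rule holomorphic_onI)
    fix z assume z: "z \<in> U"
    have "(wirtinger_bar (partial_x f) z + (-\<i>) * wirtinger_bar (partial_y f) z) / 2 = 0"
      using lap[OF z] mixed_partials[OF assms(1) z C1]
      unfolding wirtinger_bar_def by (simp add: field_simps)
    with lin[OF z, of "-\<i>"]
    have "has_wirtinger (\<lambda>w. (partial_x f w + (- \<i>) * partial_y f w) / 2)
        ((wirtinger (partial_x f) z + (- \<i>) * wirtinger (partial_y f) z) / 2) 0 z" by metis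
    moreover have "(\<lambda>w. (partial_x f w + (- \<i>) * partial_y f w) / 2) = wirtinger f"
      by (simp add: wirtinger_def fun_eq_iff)
    ultimately show "wirtinger f field_differentiable (at z within U)"
      by (metis field_differentiable_at_within has_wirtinger_0_imp_field_differentiable)
  qed
  have hol': "(\<lambda>z. cnj (wirtinger_bar f z)) holomorphic_on U"
  proof (rule holomorphic_onI)
    fix z assume z: "z \<in> U"
    have "(wirtinger (partial_x f) z + \<i> * wirtinger (partial_y f) z) / 2 = 0"
      using lap[OF z] mixed_partials[OF assms(1) z C1]
      unfolding wirtinger_def by (simp add: field_simps)
    with lin[OF z, of "\<i>"]
    have "has_wirtinger (\<lambda>w. (partial_x f w + \<i> * partial_y f w) / 2)
        0 ((wirtinger_bar (partial_x f) z + \<i> * wirtinger_bar (partial_y f) z) / 2) z" by metis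
    from has_wirtinger_cnj[OF this]
    have "(\<lambda>w. cnj ((partial_x f w + \<i> * partial_y f w) / 2)) field_differentiable (at z)"
      by (simp only: complex_cnj_zero has_wirtinger_0_imp_field_differentiable)
    moreover have "(\<lambda>w. cnj ((partial_x f w + \<i> * partial_y f w) / 2)) = (\<lambda>w. cnj (wirtinger_bar f w))"
      by (simp only: wirtinger_bar_def)
    ultimately show "(\<lambda>z. cnj (wirtinger_bar f z)) field_differentiable (at z within U)"
      by (metis field_differentiable_at_within)
  qed
  show thesis
    by (rule that[of "wirtinger f" "\<lambda>z. cnj (wirtinger_bar f z)"])
      (use hol hol' w[OF C1(1)] in \<open>auto simp: harmonic_form_def\<close>)
qed

section \<open>The Schwarzian derivative and its chain rule\<close>

lemma jacobian_harmonic_form: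
  assumes "harmonic_form f a b U" "z \<in> U"
  shows "jacobian f z = (cmod (a z))\<^sup>2 - (cmod (b z))\<^sup>2"
  using assms has_wirtinger_imp_wirtinger[of f "a z" "cnj (b z)" z]
  by (simp add: harmonic_form_def jacobian_def)

lemma of_real_jacobian_harmonic_form:
  assumes "harmonic_form f a b U" "z \<in> U"
  shows "complex_of_real (jacobian f z) = a z * cnj (a z) - b z * cnj (b z)"
  by (simp add: jacobian_harmonic_form[OF assms] flip: complex_norm_square)

text \<open>The Jacobian and all the numerators in the Schwarzian have the shape \<open>p * cnj a - q * cnj b\<close>.\<close>

lemma has_wirtinger_sesquilinear:
  assumes "(a has_field_derivative a1) (at z)" "(b has_field_derivative b1) (at z)"
    "(p has_field_derivative p1) (at z)" "(q has_field_derivative q1) (at z)"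
  shows "has_wirtinger (\<lambda>w. p w * cnj (a w) - q w * cnj (b w))
     (p1 * cnj (a z) - q1 * cnj (b z)) (p z * cnj a1 - q z * cnj b1) z"
  using has_wirtinger_diff[OF
      has_wirtinger_mult[OF has_wirtinger_holomorphic[OF assms(3)]
        has_wirtinger_cnj[OF has_wirtinger_holomorphic[OF assms(1)]]]
      has_wirtinger_mult[OF has_wirtinger_holomorphic[OF assms(4)]
        has_wirtinger_cnj[OF has_wirtinger_holomorphic[OF assms(2)]]]]
  by simp

text \<open>With \<open>J = |a|\<^sup>2 - |b|\<^sup>2\<close> the function \<open>J\<close> is real and \<open>J\<^sub>z = a' cnj a - b' cnj b\<close>, so the
  pre-Schwarzian is \<open>J\<^sub>z / J\<close> and the Schwarzian is \<open>J\<^sub>z\<^sub>z / J - 3/2 (J\<^sub>z / J)\<^sup>2\<close>.\<close>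

lemma schwarzian_harmonic_form:
  assumes "open U" "harmonic_form f a b U" "\<And>w. w \<in> U \<Longrightarrow> jacobian f w \<noteq> 0" "z \<in> U"
  shows "schwarzian f z =
     (deriv (deriv a) z * cnj (a z) - deriv (deriv b) z * cnj (b z)) / jacobian f z
     - 3 / 2 * ((deriv a z * cnj (a z) - deriv b z * cnj (b z)) / jacobian f z)\<^sup>2"
proof -
  define N1 where "N1 = (\<lambda>w. deriv a w * cnj (a w) - deriv b w * cnj (b w))"
  define N2 where "N2 = (\<lambda>w. deriv (deriv a) w * cnj (a w) - deriv (deriv b) w * cnj (b w))"
  have hol: "a holomorphic_on U" "b holomorphic_on U"
    using assms(2) by (auto simp: harmonic_form_def)
  then have hol': "deriv a holomorphic_on U" "deriv b holomorphic_on U"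
    using assms(1) by (auto intro: holomorphic_deriv)
  have J: "has_wirtinger (\<lambda>w. of_real (jacobian f w)) (N1 w) (cnj (N1 w)) w" if "w \<in> U" for w
  proof (rule has_wirtinger_cong[OF _ assms(1) that of_real_jacobian_harmonic_form[OF assms(2), symmetric]])
    show "has_wirtinger (\<lambda>w. a w * cnj (a w) - b w * cnj (b w)) (N1 w) (cnj (N1 w)) w"
      using has_wirtinger_sesquilinear[of a "deriv a w" w b "deriv b w" a "deriv a w" b "deriv b w"]
        hol assms(1) that unfolding N1_def
      by (simp add: holomorphic_derivI mult.commute)
  qed
  have N1: "has_wirtinger N1 (N2 w) (deriv a w * cnj (deriv a w) - deriv b w * cnj (deriv b w)) w"
    if "w \<in> U" for w
    unfolding N1_def N2_def
    using hol hol' assms(1) that by (intro has_wirtinger_sesquilinear) (auto intro: holomorphic_derivI)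
  have P: "pre_schwarzian f w = N1 w * inverse (of_real (jacobian f w))" if "w \<in> U" for w
    unfolding pre_schwarzian_def
    using has_wirtinger_imp_wirtinger(1)[OF has_wirtinger_ln_abs[OF J[OF that] assms(3)[OF that]]]
    by (simp add: divide_inverse)
  have "wirtinger (pre_schwarzian f) z = wirtinger (\<lambda>w. N1 w * inverse (of_real (jacobian f w))) z"
    using assms(1,4) P by (rule wirtinger_cong)
  also have "\<dots> = N1 z * (- N1 z / (of_real (jacobian f z))\<^sup>2) + N2 z * inverse (of_real (jacobian f z))"
    using has_wirtinger_imp_wirtinger(1)[OF has_wirtinger_mult[OF N1[OF assms(4)]
        has_wirtinger_inverse[OF J[OF assms(4)]]]] assms(3)[OF assms(4)] by simp
  finally show ?thesis
    unfolding schwarzian_def P[OF assms(4)] N1_def[symmetric] N2_def[symmetric]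
    unfolding N1_def[THEN fun_cong, symmetric] N2_def[THEN fun_cong, symmetric]
    by (simp add: field_simps power2_eq_square)
qed

lemma harmonic_form_comp:
  assumes "open U" "harmonic_form f a b V" "T holomorphic_on U" "T ` U \<subseteq> V"
  shows "harmonic_form (\<lambda>w. f (T w)) (\<lambda>w. a (T w) * deriv T w) (\<lambda>w. b (T w) * deriv T w) U"
proof -
  have "has_wirtinger (\<lambda>w. f (T w)) (a (T z) * deriv T z) (cnj (b (T z) * deriv T z)) z"
    if "z \<in> U" for z
    using has_wirtinger_comp_holomorphic[of f "a (T z)" "cnj (b (T z))" T z "deriv T z"]
      assms that by (auto simp: harmonic_form_def holomorphic_derivI)
  moreover have "(\<lambda>w. a (T w)) holomorphic_on U" "(\<lambda>w. b (T w)) holomorphic_on U"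
    using assms holomorphic_on_compose_gen[of T U _ V] by (auto simp: harmonic_form_def o_def)
  ultimately show ?thesis
    unfolding harmonic_form_def using assms by (auto intro!: holomorphic_intros holomorphic_deriv)
qed

lemma jacobian_comp:
  assumes "open U" "harmonic_form f a b V" "T holomorphic_on U" "T ` U \<subseteq> V" "z \<in> U"
  shows "jacobian (\<lambda>w. f (T w)) z = jacobian f (T z) * (cmod (deriv T z))\<^sup>2"
  using assms(4,5)
  by (subst jacobian_harmonic_form[OF harmonic_form_comp[OF assms(1-4)] assms(5)],
      subst jacobian_harmonic_form[OF assms(2)])
    (auto simp: norm_mult power_mult_distrib algebra_simps)

text \<open>The same chain rule as for the classical Schwarzian: the extra term is the Schwarzian of \<open>T\<close>,
  because \<open>ln |J|\<close> of the composition is \<open>ln |J|\<close> of \<open>f\<close> at \<open>T z\<close> plus \<open>ln |T'|\<^sup>2\<close>.\<close>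

lemma schwarzian_comp_holomorphic:
  assumes "open U" "open V" "harmonic_form f a b V" "\<And>w. w \<in> V \<Longrightarrow> jacobian f w \<noteq> 0"
    and "T holomorphic_on U" "T ` U \<subseteq> V" "\<And>w. w \<in> U \<Longrightarrow> deriv T w \<noteq> 0" "z \<in> U"
  shows "schwarzian (\<lambda>w. f (T w)) z = schwarzian f (T z) * (deriv T z)\<^sup>2
     + (deriv (deriv (deriv T)) z / deriv T z - 3 / 2 * (deriv (deriv T) z / deriv T z)\<^sup>2)"
proof -
  have hol: "a holomorphic_on V" "b holomorphic_on V"
    using assms(3) by (auto simp: harmonic_form_def)
  have hol': "deriv a holomorphic_on V" "deriv b holomorphic_on V"
    using hol assms(2) by (auto intro: holomorphic_deriv)
  have Thol: "deriv T holomorphic_on U" "deriv (deriv T) holomorphic_on U"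
    using assms(1,5) by (auto intro: holomorphic_deriv)
  have dT: "(T has_field_derivative deriv T w) (at w)"
    "(deriv T has_field_derivative deriv (deriv T) w) (at w)"
    "(deriv (deriv T) has_field_derivative deriv (deriv (deriv T)) w) (at w)" if "w \<in> U" for w
    using assms(1,5) Thol that by (auto intro: holomorphic_derivI)
  have d1: "deriv (\<lambda>w. p (T w) * deriv T w) w = deriv p (T w) * (deriv T w)\<^sup>2 + p (T w) * deriv (deriv T) w"
    if "p holomorphic_on V" "w \<in> U" for p w
  proof -
    have "T w \<in> V" using that(2) assms(6) by auto
    then have "((\<lambda>w. p (T w)) has_field_derivative deriv p (T w) * deriv T w) (at w)"
      by (intro DERIV_chain2[OF _ dT(1)[OF that(2)]] holomorphic_derivI[OF that(1) assms(2)])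
    from DERIV_imp_deriv[OF DERIV_mult[OF this dT(2)[OF that(2)]]] show ?thesis
      by (simp add: power2_eq_square algebra_simps)
  qed
  have d2: "deriv (deriv (\<lambda>w. p (T w) * deriv T w)) z
      = deriv (deriv p) (T z) * (deriv T z)^3 + 3 * deriv p (T z) * deriv T z * deriv (deriv T) z
        + p (T z) * deriv (deriv (deriv T)) z"
    if p: "p holomorphic_on V" for p
  proof -
    have Tz: "T z \<in> V" using assms(6,8) by auto
    have p': "deriv p holomorphic_on V" using p assms(2) by (rule holomorphic_deriv)
    have e: "((\<lambda>w. q (T w)) has_field_derivative deriv q (T z) * deriv T z) (at z)"
      if "q holomorphic_on V" for q
      by (intro DERIV_chain2[OF _ dT(1)[OF assms(8)]] holomorphic_derivI[OF that assms(2) Tz])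
    have "deriv (deriv (\<lambda>w. p (T w) * deriv T w)) z
        = deriv (\<lambda>w. deriv p (T w) * (deriv T w)\<^sup>2 + p (T w) * deriv (deriv T) w) z"
      by (rule deriv_cong_ev[OF eventually_nhds_in_open[THEN eventually_mono]])
        (use assms(1,8) d1[OF p] in auto)
    also have "\<dots> = deriv (deriv p) (T z) * (deriv T z)^3 + 3 * deriv p (T z) * deriv T z * deriv (deriv T) z
        + p (T z) * deriv (deriv (deriv T)) z"
      by (rule DERIV_imp_deriv)
        (auto intro!: derivative_eq_intros e[OF p] e[OF p'] dT assms(8)
          simp: power2_eq_square power3_eq_cube algebra_simps)
    finally show ?thesis .
  qed
  define t where "t = deriv T z"
  define t2 where "t2 = deriv (deriv T) z"
  define t3 where "t3 = deriv (deriv (deriv T)) z"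
  define J where "J = complex_of_real (jacobian f (T z))"
  define N1 where "N1 = deriv a (T z) * cnj (a (T z)) - deriv b (T z) * cnj (b (T z))"
  define N2 where "N2 = deriv (deriv a) (T z) * cnj (a (T z)) - deriv (deriv b) (T z) * cnj (b (T z))"
  have Tz: "T z \<in> V" using assms(6,8) by auto
  have nz: "J \<noteq> 0" "t \<noteq> 0" using assms(4)[OF Tz] assms(7,8) by (auto simp: J_def t_def)
  have Jab: "J = a (T z) * cnj (a (T z)) - b (T z) * cnj (b (T z))"
    unfolding J_def by (rule of_real_jacobian_harmonic_form[OF assms(3) Tz])
  note hf = harmonic_form_comp[OF assms(1,3,5,6)]
  have jnz: "jacobian (\<lambda>w. f (T w)) w \<noteq> 0" if "w \<in> U" for w
    using jacobian_comp[OF assms(1,3,5,6) that] assms(4,6,7) that by auto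
  have Jc: "complex_of_real (jacobian (\<lambda>w. f (T w)) z) = J * (t * cnj t)"
    unfolding jacobian_comp[OF assms(1,3,5,6,8)] J_def t_def
    by (simp flip: complex_norm_square)
  have n2: "deriv (deriv (\<lambda>w. a (T w) * deriv T w)) z * cnj (a (T z) * deriv T z)
      - deriv (deriv (\<lambda>w. b (T w) * deriv T w)) z * cnj (b (T z) * deriv T z)
      = cnj t * (N2 * t^3 + 3 * N1 * t * t2 + J * t3)"
    unfolding d2[OF hol(1)] d2[OF hol(2)] t_def[symmetric] t2_def[symmetric] t3_def[symmetric]
      Jab N1_def N2_def by (simp add: algebra_simps)
  have n1: "deriv (\<lambda>w. a (T w) * deriv T w) z * cnj (a (T z) * deriv T z)
      - deriv (\<lambda>w. b (T w) * deriv T w) z * cnj (b (T z) * deriv T z)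
      = cnj t * (N1 * t\<^sup>2 + J * t2)"
    unfolding d1[OF hol(1) assms(8)] d1[OF hol(2) assms(8)] t_def[symmetric] t2_def[symmetric]
      Jab N1_def by (simp add: algebra_simps)
  have "schwarzian (\<lambda>w. f (T w)) z =
     (cnj t * (N2 * t^3 + 3 * N1 * t * t2 + J * t3)) / (J * (t * cnj t))
     - 3 / 2 * ((cnj t * (N1 * t\<^sup>2 + J * t2)) / (J * (t * cnj t)))\<^sup>2"
    unfolding n1[symmetric] n2[symmetric] Jc[symmetric]
    by (rule schwarzian_harmonic_form[OF assms(1) hf _ assms(8)]) (rule jnz)
  also have "\<dots> = (N2 / J * t\<^sup>2 + 3 * (N1 / J) * t2 + t3 / t) - 3 / 2 * (N1 / J * t + t2 / t)\<^sup>2"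
    using nz by (simp add: field_simps power2_eq_square power3_eq_cube)
  also have "\<dots> = (N2 / J - 3 / 2 * (N1 / J)\<^sup>2) * t\<^sup>2 + (t3 / t - 3 / 2 * (t2 / t)\<^sup>2)"
    using nz by (simp add: field_simps power2_eq_square)
  also have "N2 / J - 3 / 2 * (N1 / J)\<^sup>2 = schwarzian f (T z)"
    unfolding J_def N1_def N2_def
    by (rule schwarzian_harmonic_form[OF assms(2,3) _ Tz, symmetric]) (rule assms(4))
  finally show ?thesis unfolding t_def t2_def t3_def .
qed

lemma mobius_derivs:
  fixes A B C D :: complex
  assumes "open U" "\<And>w. w \<in> U \<Longrightarrow> C * w + D \<noteq> 0" "z \<in> U"
    and T: "\<And>w. w \<in> U \<Longrightarrow> T w = (A * w + B) / (C * w + D)"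
  shows "(T has_field_derivative (A * D - B * C) / (C * z + D)\<^sup>2) (at z)"
    and "deriv T z = (A * D - B * C) / (C * z + D)\<^sup>2"
    and "deriv (deriv T) z = - 2 * C * (A * D - B * C) / (C * z + D)^3"
    and "deriv (deriv (deriv T)) z = 6 * C\<^sup>2 * (A * D - B * C) / (C * z + D)^4"
proof -
  have step: "deriv p z = q' z"
    if "\<And>w. w \<in> U \<Longrightarrow> p w = q w" "\<And>w. w \<in> U \<Longrightarrow> (q has_field_derivative q' w) (at w)" "z \<in> U"
    for p q q' z
    by (intro DERIV_imp_deriv has_field_derivative_transform_within_open[OF that(2)[OF that(3)] assms(1) that(3)])
      (simp add: that(1))
  have lin: "((\<lambda>w. C * w + D) has_field_derivative C) (at w)" for w
    by (auto intro!: derivative_eq_intros)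
  have q1: "((\<lambda>w. (A * w + B) / (C * w + D)) has_field_derivative (A * D - B * C) / (C * w + D)\<^sup>2) (at w)"
    if "w \<in> U" for w
  proof -
    have "((\<lambda>w. A * w + B) has_field_derivative A) (at w)"
      by (auto intro!: derivative_eq_intros)
    from DERIV_quotient[OF this lin assms(2)[OF that]] show ?thesis
      by (simp add: algebra_simps power2_eq_square)
  qed
  have pow: "((\<lambda>w. K / (C * w + D)^n) has_field_derivative
      (0 * (C * w + D)^n - (of_nat n * (C * (C * w + D)^(n - Suc 0))) * K) / ((C * w + D)^n)^Suc (Suc 0)) (at w)"
    if "w \<in> U" for w n and K :: complex
    by (rule DERIV_quotient[OF DERIV_const DERIV_power[OF lin]]) (use assms(2)[OF that] in simp)
  have alg: "(0 * L\<^sup>2 - (of_nat 2 * (C * L^(2 - Suc 0))) * K) / (L\<^sup>2)^Suc (Suc 0) = - 2 * C * K / L^3"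
    "(0 * L^3 - (of_nat 3 * (C * L^(3 - Suc 0))) * (- 2 * C * K)) / (L^3)^Suc (Suc 0) = 6 * C\<^sup>2 * K / L^4"
    if "L \<noteq> 0" for K L :: complex
    using that by (simp_all add: field_simps eval_nat_numeral)
  have q2: "((\<lambda>w. (A * D - B * C) / (C * w + D)\<^sup>2) has_field_derivative
      - 2 * C * (A * D - B * C) / (C * w + D)^3) (at w)" if "w \<in> U" for w
    using pow[OF that, of "A * D - B * C" 2] unfolding alg(1)[OF assms(2)[OF that]] .
  have q3: "((\<lambda>w. - 2 * C * (A * D - B * C) / (C * w + D)^3) has_field_derivative
      6 * C\<^sup>2 * (A * D - B * C) / (C * w + D)^4) (at w)" if "w \<in> U" for w
    using pow[OF that, of "- 2 * C * (A * D - B * C)" 3] unfolding alg(2)[OF assms(2)[OF that]] .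
  have 1: "deriv T w = (A * D - B * C) / (C * w + D)\<^sup>2" if "w \<in> U" for w
    by (rule step[OF T q1 that])
  have 2: "deriv (deriv T) w = - 2 * C * (A * D - B * C) / (C * w + D)^3" if "w \<in> U" for w
    by (rule step[OF 1 q2 that])
  show "(T has_field_derivative (A * D - B * C) / (C * z + D)\<^sup>2) (at z)"
    by (rule has_field_derivative_transform_within_open[OF q1 assms(1)]) (auto simp: assms)
  show "deriv T z = (A * D - B * C) / (C * z + D)\<^sup>2" by (rule 1[OF assms(3)])
  show "deriv (deriv T) z = - 2 * C * (A * D - B * C) / (C * z + D)^3" by (rule 2[OF assms(3)])
  show "deriv (deriv (deriv T)) z = 6 * C\<^sup>2 * (A * D - B * C) / (C * z + D)^4"
    by (rule step[OF 2 q3 assms(3)])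
qed

text \<open>Moebius maps have vanishing Schwarzian, so \<open>S\<^sub>f\<close> transforms under them like a quadratic
  differential, just as the square of the hyperbolic density does.\<close>

lemma schwarzian_comp_mobius:
  fixes A B C D :: complex
  assumes "open U" "open V" "harmonic_on f V" "\<And>w. w \<in> V \<Longrightarrow> jacobian f w \<noteq> 0"
    and "\<And>w. w \<in> U \<Longrightarrow> T w = (A * w + B) / (C * w + D)" "\<And>w. w \<in> U \<Longrightarrow> C * w + D \<noteq> 0"
    and "A * D - B * C \<noteq> 0" "T ` U \<subseteq> V"
  shows "harmonic_on (\<lambda>w. f (T w)) U"
    and "z \<in> U \<Longrightarrow> jacobian (\<lambda>w. f (T w)) z \<noteq> 0"
    and "z \<in> U \<Longrightarrow> schwarzian (\<lambda>w. f (T w)) z = schwarzian f (T z) * (deriv T z)\<^sup>2"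
proof -
  obtain a b where hf: "harmonic_form f a b V"
    using harmonic_on_imp_harmonic_form[OF assms(2,3)] by blast
  have d: "(T has_field_derivative (A * D - B * C) / (C * w + D)\<^sup>2) (at w)"
    "deriv T w = (A * D - B * C) / (C * w + D)\<^sup>2"
    "deriv (deriv T) w = - 2 * C * (A * D - B * C) / (C * w + D)^3"
    "deriv (deriv (deriv T)) w = 6 * C\<^sup>2 * (A * D - B * C) / (C * w + D)^4" if "w \<in> U" for w
    using mobius_derivs[of U C D w T A B] assms that by blast+
  have hol: "T holomorphic_on U"
    using d(1) has_field_derivative_at_within
    unfolding holomorphic_on_def field_differentiable_def by blast
  have nz: "deriv T w \<noteq> 0" if "w \<in> U" for w
    using assms(6,7) that by (simp add: d(2))
  show "harmonic_on (\<lambda>w. f (T w)) U"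
    by (rule harmonic_form_imp_harmonic_on[OF assms(1) harmonic_form_comp[OF assms(1) hf hol assms(8)]])
  show "jacobian (\<lambda>w. f (T w)) z \<noteq> 0" if "z \<in> U"
    using jacobian_comp[OF assms(1) hf hol assms(8) that] nz[OF that] assms(4,8) that by auto
  show "schwarzian (\<lambda>w. f (T w)) z = schwarzian f (T z) * (deriv T z)\<^sup>2" if z: "z \<in> U"
  proof -
    have "deriv (deriv (deriv T)) z / deriv T z - 3 / 2 * (deriv (deriv T) z / deriv T z)\<^sup>2 = 0"
    proof -
      have "6 * C\<^sup>2 * K / L^4 / (K / L\<^sup>2) - 3 / 2 * (- 2 * C * K / L^3 / (K / L\<^sup>2))\<^sup>2 = 0"
        if "K \<noteq> 0" "L \<noteq> 0" for K L :: complex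
        using that by (simp add: field_simps eval_nat_numeral)
      from this[OF assms(7) assms(6)[OF z]] show ?thesis unfolding d(2,3,4)[OF z] .
    qed
    with schwarzian_comp_holomorphic[OF assms(1,2) hf _ hol assms(8) _ z] assms(4) nz
    show ?thesis by simp
  qed
qed

section \<open>Local injectivity and Lewy's theorem\<close>

lemma harmonic_form_locally_injective:
  assumes "open U" "harmonic_form f a b U" "z \<in> U" "jacobian f z \<noteq> 0"
  obtains r where "r > 0" "ball z r \<subseteq> U" "inj_on f (ball z r)"
proof -
  define J where "J = complex_of_real (jacobian f z)"
  define g' where "g' = (\<lambda>w. (cnj (a z) * w - cnj (b z) * cnj w) / J)"
  define f' where "f' = (\<lambda>x v. a x * v + cnj (b x) * cnj v)"
  have J: "J \<noteq> 0" "J = a z * cnj (a z) - b z * cnj (b z)"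
    using assms(4) of_real_jacobian_harmonic_form[OF assms(2,3)] by (auto simp: J_def)
  have hol: "a holomorphic_on U" "b holomorphic_on U"
    and w: "\<And>z. z \<in> U \<Longrightarrow> has_wirtinger f (a z) (cnj (b z)) z"
    using assms(2) unfolding harmonic_form_def by auto
  have cont: "isCont a z" "isCont b z"
    using hol assms(1,3) by (auto dest!: holomorphic_on_imp_continuous_on simp: continuous_on_eq_continuous_at)
  show thesis
  proof (rule has_derivative_locally_injective[OF assms(3,1), where f = f and f' = f' and g' = g'])
    have "bounded_linear (\<lambda>w. (cnj (a z) / J) * w + - ((cnj (b z) / J) * cnj w))"
      by (intro bounded_linear_add bounded_linear_minus bounded_linear_mult_right
          bounded_linear_compose[OF bounded_linear_mult_right] bounded_linear_cnj)
    also have "(\<lambda>w. (cnj (a z) / J) * w + - ((cnj (b z) / J) * cnj w)) = g'"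
      by (simp add: g'_def diff_divide_distrib fun_eq_iff)
    finally show "bounded_linear g'" .
    have "g' (f' z v) = v" for v
    proof -
      have "g' (f' z v) = J * v / J"
        unfolding g'_def f'_def J(2) by (simp add: algebra_simps)
      with J show ?thesis by simp
    qed
    then show "g' \<circ> f' z = id" by (simp add: fun_eq_iff)
    show "(f has_derivative f' x) (at x)" if "x \<in> U" for x
      using w[OF that] unfolding has_wirtinger_def f'_def by simp
    fix e :: real assume "e > 0"
    obtain d1 where d1: "d1 > 0" "\<And>w. dist w z < d1 \<Longrightarrow> dist (a w) (a z) < e / 3"
      using cont(1) \<open>e > 0\<close> unfolding continuous_at_eps_delta by (metis divide_pos_pos zero_less_numeral)
    obtain d2 where d2: "d2 > 0" "\<And>w. dist w z < d2 \<Longrightarrow> dist (b w) (b z) < e / 3"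
      using cont(2) \<open>e > 0\<close> unfolding continuous_at_eps_delta by (metis divide_pos_pos zero_less_numeral)
    have "onorm (\<lambda>v. f' x v - f' z v) < e" if "dist z x < min d1 d2" for x
    proof -
      have d: "dist (a x) (a z) < e / 3" "dist (b x) (b z) < e / 3"
        using that d1 d2 by (auto simp: dist_commute)
      have "onorm (\<lambda>v. f' x v - f' z v) \<le> 2 * e / 3"
      proof (rule onorm_bound)
        show "0 \<le> 2 * e / 3" using \<open>e > 0\<close> by simp
        fix v :: complex
        have "f' x v - f' z v = (a x - a z) * v + cnj ((b x - b z) * v)"
          by (simp add: f'_def algebra_simps)
        also have "norm \<dots> \<le> cmod (a x - a z) * cmod v + cmod (b x - b z) * cmod v"
          by (metis complex_mod_cnj norm_mult norm_triangle_ineq)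
        also have "\<dots> \<le> e / 3 * cmod v + e / 3 * cmod v"
          using d by (intro add_mono mult_right_mono) (auto simp: dist_norm)
        finally show "norm (f' x v - f' z v) \<le> 2 * e / 3 * norm v" by simp
      qed
      with \<open>e > 0\<close> show ?thesis by linarith
    qed
    with d1 d2 show "\<exists>d>0. \<forall>x. dist z x < d \<longrightarrow> onorm (\<lambda>v. f' x v - f' z v) < e"
      by (intro exI[of _ "min d1 d2"]) auto
  qed (use that in blast)
qed

text \<open>Among three arcs on a line with the common starting point \<open>c\<close>, two leave \<open>c\<close> on the same side, and
  then the longer one runs over the end point of the shorter one.\<close>

lemma no_three_disjoint_arcs_in_line:
  fixes \<phi> :: "nat \<Rightarrow> real \<Rightarrow> real"
  assumes "\<delta> > 0" "\<And>k. k < 3 \<Longrightarrow> continuous_on {0..\<delta>} (\<phi> k)" "\<And>k. k < 3 \<Longrightarrow> \<phi> k 0 = c"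
    and inj: "\<And>j k s t. j < 3 \<Longrightarrow> k < 3 \<Longrightarrow> 0 \<le> s \<Longrightarrow> s \<le> \<delta> \<Longrightarrow> 0 < t \<Longrightarrow> t \<le> \<delta> \<Longrightarrow>
      \<phi> j s = \<phi> k t \<Longrightarrow> j = k \<and> s = t"
  shows False
proof -
  have aux: "j = k" if "j < 3" "k < 3" "\<sigma> * c < \<sigma> * \<phi> j \<delta>" "\<sigma> * \<phi> j \<delta> \<le> \<sigma> * \<phi> k \<delta>"
    for j k and \<sigma> :: real
  proof -
    have "continuous_on {0..\<delta>} (\<lambda>t. \<sigma> * \<phi> k t)"
      using assms(2)[OF that(2)] by (rule continuous_on_mult_left)
    then have "\<exists>t\<ge>0. t \<le> \<delta> \<and> \<sigma> * \<phi> k t = \<sigma> * \<phi> j \<delta>"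
      using assms(1) that(3,4) assms(3)[OF that(2)] by (intro IVT') auto
    moreover have "\<sigma> \<noteq> 0" using that by auto
    ultimately obtain t where "0 \<le> t" "t \<le> \<delta>" "\<phi> k t = \<phi> j \<delta>" by auto
    with inj[of k j t \<delta>] that assms(1) show ?thesis by auto
  qed
  have same: "j = k" if "j < 3" "k < 3" "\<sigma> * c < \<sigma> * \<phi> j \<delta>" "\<sigma> * c < \<sigma> * \<phi> k \<delta>"
    for j k and \<sigma> :: real
    using aux[of j k \<sigma>] aux[of k j \<sigma>] that by linarith
  have ne: "\<phi> k \<delta> \<noteq> c" if "k < 3" for k
    using inj[of k k 0 \<delta>] assms(1,3) that by auto
  have "\<phi> k \<delta> < c \<or> c < \<phi> k \<delta>" if "k < 3" for k using ne[OF that] by linarith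
  then have "\<phi> 0 \<delta> < c \<or> c < \<phi> 0 \<delta>" "\<phi> 1 \<delta> < c \<or> c < \<phi> 1 \<delta>" "\<phi> 2 \<delta> < c \<or> c < \<phi> 2 \<delta>"
    by auto
  then show False
    using same[of 0 1 1] same[of 0 2 1] same[of 1 2 1]
      same[of 0 1 "-1"] same[of 0 2 "-1"] same[of 1 2 "-1"] by auto
qed

text \<open>Near a critical point, \<open>F\<close> is a constant plus the \<open>n\<close>-th power of a local coordinate, with
  \<open>n \<ge> 2\<close>. The parametrization \<open>q\<close> is the inverse of this coordinate, and the level set of the real
  part contains the images under \<open>q\<close> of the \<open>2 n \<ge> 4\<close> rays on which \<open>\<zeta> ^ n\<close> is imaginary. If \<open>F\<close> is
  constant, a translation with \<open>n = 2\<close> serves.\<close>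

lemma critical_level_set:
  assumes "F holomorphic_on ball z r" "r > 0" "deriv F z = 0"
  obtains \<epsilon> q n where "\<epsilon> > 0" "continuous_on (ball 0 \<epsilon>) q" "inj_on q (ball 0 \<epsilon>)" "q 0 = z"
    "q ` ball 0 \<epsilon> \<subseteq> ball z r" "n \<ge> (2::nat)"
    "\<And>\<zeta>. \<zeta> \<in> ball 0 \<epsilon> \<Longrightarrow> Re (\<zeta> ^ n) = 0 \<Longrightarrow> Re (F (q \<zeta>)) = Re (F z)"
proof (cases "\<forall>n>0. (deriv ^^ n) F z = 0")
  case True
  have const: "F w = F z" if "w \<in> ball z r" for w
    by (rule holomorphic_fun_eq_const_on_connected[OF assms(1)]) (use True that assms(2) in auto)
  show thesis
    by (rule that[of r "\<lambda>\<zeta>. z + \<zeta>" 2])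
      (use assms(2) in \<open>auto intro!: continuous_intros arg_cong[where f = Re] const simp: dist_norm\<close>)
next
  case False
  define n where "n = (LEAST n. 0 < n \<and> (deriv ^^ n) F z \<noteq> 0)"
  have n: "0 < n" "(deriv ^^ n) F z \<noteq> 0"
    using LeastI_ex[of "\<lambda>n. 0 < n \<and> (deriv ^^ n) F z \<noteq> 0"] False unfolding n_def by auto
  have least: "(deriv ^^ i) F z = 0" if "0 < i" "i < n" for i
    using not_less_Least[of i "\<lambda>n. 0 < n \<and> (deriv ^^ n) F z \<noteq> 0"] that unfolding n_def by auto
  have "n \<noteq> 1" using n(2) assms(3) by auto
  then have n2: "n \<ge> 2" using n(1) by simp
  obtain g r1 where g: "0 < r1" "g holomorphic_on ball z r1"
    "\<And>w. w \<in> ball z r1 \<Longrightarrow> F w - F z = ((w - z) * g w) ^ n" "\<And>w. w \<in> ball z r1 \<Longrightarrow> g w \<noteq> 0"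
    using holomorphic_factor_order_of_zero_strong[OF assms(1) open_ball _ n(1,2) least] assms(2)
    by (metis centre_in_ball)
  define \<psi> where "\<psi> = (\<lambda>w. (w - z) * g w)"
  define R where "R = min r r1"
  have R: "0 < R" "ball z R \<subseteq> ball z r" "ball z R \<subseteq> ball z r1" using assms(2) g(1) by (auto simp: R_def)
  have hol: "\<psi> holomorphic_on ball z R"
    unfolding \<psi>_def using holomorphic_on_subset[OF g(2) R(3)] by (intro holomorphic_intros)
  have "(g has_field_derivative deriv g z) (at z)"
    using g(1,2) by (intro holomorphic_derivI[of _ "ball z r1"]) auto
  then have "(\<psi> has_field_derivative g z) (at z)"
    unfolding \<psi>_def by (auto intro!: derivative_eq_intros)
  then have "deriv \<psi> z \<noteq> 0" using g(1,4) by (simp add: DERIV_imp_deriv)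
  then obtain \<rho> where \<rho>: "\<rho> > 0" "ball z \<rho> \<subseteq> ball z R" "open (\<psi> ` ball z \<rho>)" "inj_on \<psi> (ball z \<rho>)"
    using has_complex_derivative_locally_invertible[OF hol _ open_ball] R(1) by (metis centre_in_ball)
  obtain q where q: "q holomorphic_on (\<psi> ` ball z \<rho>)" "\<And>w. w \<in> ball z \<rho> \<Longrightarrow> q (\<psi> w) = w"
    using holomorphic_has_inverse[OF holomorphic_on_subset[OF hol \<rho>(2)] open_ball \<rho>(4)] by metis
  have \<psi>z: "\<psi> z = 0" by (simp add: \<psi>_def)
  then have "0 \<in> \<psi> ` ball z \<rho>" using \<rho>(1) by (metis centre_in_ball imageI)
  then obtain \<epsilon> where \<epsilon>: "\<epsilon> > 0" "ball 0 \<epsilon> \<subseteq> \<psi> ` ball z \<rho>" using \<rho>(3) openE by blast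
  have pre: "\<psi> (q \<zeta>) = \<zeta>" "q \<zeta> \<in> ball z \<rho>" if "\<zeta> \<in> ball 0 \<epsilon>" for \<zeta>
  proof -
    from that \<epsilon>(2) obtain w where "w \<in> ball z \<rho>" "\<zeta> = \<psi> w" by blast
    with q(2) show "\<psi> (q \<zeta>) = \<zeta>" "q \<zeta> \<in> ball z \<rho>" by simp_all
  qed
  show thesis
  proof (rule that[OF \<epsilon>(1) _ _ _ _ n2])
    show "continuous_on (ball 0 \<epsilon>) q"
      using q(1) \<epsilon>(2) continuous_on_subset holomorphic_on_imp_continuous_on by blast
    show "inj_on q (ball 0 \<epsilon>)" using pre(1) by (metis inj_onI)
    show "q 0 = z" using q(2)[of z] \<psi>z \<rho>(1) by simp
    show "q ` ball 0 \<epsilon> \<subseteq> ball z r" using pre(2) \<rho>(2) R(2) by blast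
    fix \<zeta> :: complex assume \<zeta>: "\<zeta> \<in> ball 0 \<epsilon>" "Re (\<zeta> ^ n) = 0"
    have "F (q \<zeta>) - F z = \<zeta> ^ n"
    proof -
      have "q \<zeta> \<in> ball z r1" using pre(2)[OF \<zeta>(1)] \<rho>(2) R(3) by blast
      from g(3)[OF this] pre(1)[OF \<zeta>(1)] show ?thesis by (simp add: \<psi>_def)
    qed
    then have "F (q \<zeta>) = F z + \<zeta> ^ n" by (simp add: algebra_simps)
    with \<zeta>(2) show "Re (F (q \<zeta>)) = Re (F z)" by simp
  qed
qed

text \<open>If the Jacobian vanishes at \<open>z\<close>, the real part of some rotation of \<open>f\<close> has a critical point at
  \<open>z\<close> and is locally the real part of a holomorphic function. Its level set through \<open>z\<close> contains at
  least four arcs issuing from \<open>z\<close>, three of which are used. An injective \<open>f\<close> would embed them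
  disjointly, apart from their common starting point, into a vertical line.\<close>

theorem Lewy:
  assumes "open U" "harmonic_form f a b U" "z \<in> U" "inj_on f U"
  shows "jacobian f z \<noteq> 0"
proof
  assume "jacobian f z = 0"
  then have ab: "cmod (a z) = cmod (b z)"
    using jacobian_harmonic_form[OF assms(2,3)] by (simp add: power2_eq_iff_nonneg)
  have hol: "a holomorphic_on U" "b holomorphic_on U"
    and w: "\<And>z. z \<in> U \<Longrightarrow> has_wirtinger f (a z) (cnj (b z)) z"
    using assms(2) unfolding harmonic_form_def by auto
  \<comment> \<open>The gradients of the real and imaginary parts are linearly dependent at \<open>z\<close>; the unit number \<open>e\<close>
    rotates the image so that the real part of \<open>e * f\<close> is the one with a critical point there.\<close>
  obtain e where e: "cmod e = 1" "e * a z + cnj e * b z = 0"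
  proof (cases "a z = 0")
    case True
    with ab that[of 1] show thesis by simp
  next
    case False
    define e where "e = csqrt (- b z / a z)"
    have e2: "e\<^sup>2 = - b z / a z" by (simp add: e_def)
    have "b z \<noteq> 0" using False ab by auto
    then have "(cmod e)\<^sup>2 = 1\<^sup>2" using ab by (simp add: e2 norm_divide flip: norm_power)
    then have n1: "cmod e = 1" by (rule power2_eq_imp_eq) auto
    have "cnj e * e = 1" using n1 complex_norm_square[of e] by (simp add: mult.commute)
    have "e * a z + cnj e * b z = cnj e * e * e * a z + cnj e * b z"
      using \<open>cnj e * e = 1\<close> by simp
    also have "\<dots> = cnj e * (e\<^sup>2 * a z + b z)" by (simp add: power2_eq_square algebra_simps)
    also have "\<dots> = 0" using False by (simp add: e2)
    finally show thesis using that n1 by blast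
  qed
  obtain r where r: "r > 0" "ball z r \<subseteq> U" using assms(1,3) openE by blast
  have hol_e: "(\<lambda>w. e * a w + cnj e * b w) holomorphic_on ball z r"
    by (intro holomorphic_intros holomorphic_on_subset[OF hol(1) r(2)] holomorphic_on_subset[OF hol(2) r(2)])
  obtain F where F0: "\<And>w. w \<in> ball z r \<Longrightarrow> (F has_field_derivative e * a w + cnj e * b w) (at w within ball z r)"
    by (rule holomorphic_convex_primitive'[OF convex_ball open_ball hol_e]) blast
  have F: "(F has_field_derivative e * a w + cnj e * b w) (at w)" if "w \<in> ball z r" for w
    using F0[OF that] at_within_open[OF that open_ball] by simp
  have Fhol: "F holomorphic_on ball z r"
    using F0 unfolding holomorphic_on_def field_differentiable_def by blast
  have dF: "deriv F z = 0" using F[of z] r(1) e(2) DERIV_imp_deriv by force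
  have diff: "((\<lambda>w. Re (e * f w) - Re (F w)) has_derivative (\<lambda>v. 0)) (at w)" if w': "w \<in> ball z r" for w
  proof -
    have "(f has_derivative (\<lambda>v. a w * v + cnj (b w) * cnj v)) (at w)"
      using w w' r(2) unfolding has_wirtinger_def by blast
    from has_derivative_diff[OF has_derivative_Re[OF has_derivative_mult_right[OF this, of e]]
        has_derivative_Re[OF F[OF w', unfolded has_field_derivative_def]]]
    have "((\<lambda>w. Re (e * f w) - Re (F w)) has_derivative
      (\<lambda>v. Re (e * (a w * v + cnj (b w) * cnj v)) - Re ((e * a w + cnj e * b w) * v))) (at w)" .
    moreover have "Re (e * (a w * v + cnj (b w) * cnj v)) - Re ((e * a w + cnj e * b w) * v) = 0" for v
      by (simp add: algebra_simps)
    ultimately show ?thesis by simp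
  qed
  have Re: "Re (e * f w) = Re (F w) + (Re (e * f z) - Re (F z))" if "w \<in> ball z r" for w
    using has_derivative_zero_unique[OF convex_ball has_derivative_at_withinI[OF diff] that, of z] r(1)
    by simp
  obtain \<epsilon> q n where q: "\<epsilon> > 0" "continuous_on (ball 0 \<epsilon>) q" "inj_on q (ball 0 \<epsilon>)" "q 0 = z"
    "q ` ball 0 \<epsilon> \<subseteq> ball z r" "n \<ge> (2::nat)"
    "\<And>\<zeta>. \<zeta> \<in> ball 0 \<epsilon> \<Longrightarrow> Re (\<zeta> ^ n) = 0 \<Longrightarrow> Re (F (q \<zeta>)) = Re (F z)"
    using critical_level_set[OF Fhol r(1) dF] by metis
  \<comment> \<open>Along the ray at the angle \<open>\<theta> k\<close> the power \<open>\<zeta> ^ n\<close> is imaginary. As \<open>n \<ge> 2\<close>, the rays for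
    \<open>k < 3\<close> are distinct.\<close>
  define \<theta> where "\<theta> = (\<lambda>k::nat. (2 * real k + 1) * pi / (2 * real n))"
  define ray where "ray = (\<lambda>k t. complex_of_real t * cis (\<theta> k))"
  define \<phi> where "\<phi> = (\<lambda>k t. Im (e * f (q (ray k t))))"
  have ray: "ray k t \<in> ball 0 \<epsilon>" if "0 \<le> t" "t \<le> \<epsilon> / 2" for k t
    using that q(1) by (simp add: ray_def norm_mult)
  have ray0: "Re (ray k t ^ n) = 0" for k t
  proof -
    have th: "real n * \<theta> k = pi / 2 + real k * pi" using q(6) by (simp add: \<theta>_def field_simps)
    have "cis (\<theta> k) ^ n = cis (real n * \<theta> k)" by (rule Complex.DeMoivre)
    then have c: "cis (\<theta> k) ^ n = cis (pi / 2 + real k * pi)" by (simp only: th)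
    have "ray k t ^ n = of_real (t ^ n) * cis (pi / 2 + real k * pi)"
      unfolding ray_def power_mult_distrib c of_real_power ..
    then have "Re (ray k t ^ n) = t ^ n * cos (pi / 2 + real k * pi)" by simp
    then show ?thesis by (simp add: cos_add)
  qed
  have inU: "q (ray k t) \<in> ball z r" if "0 \<le> t" "t \<le> \<epsilon> / 2" for k t
    using ray[OF that, of k] q(5) by (simp only: image_subset_iff)
  have level: "Re (e * f (q (ray k t))) = Re (e * f z)" if "0 \<le> t" "t \<le> \<epsilon> / 2" for k t
    using Re[OF inU[OF that]] q(7)[OF ray[OF that] ray0] by simp
  have fcont: "continuous_on (ball z r) f"
  proof (rule continuous_at_imp_continuous_on, rule ballI)
    fix x assume "x \<in> ball z r"
    then have "f differentiable (at x)" using w r(2) has_wirtinger_differentiable by blast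
    then show "isCont f x" by (rule differentiable_imp_continuous_within)
  qed
  have e0: "e \<noteq> 0" using e(1) by auto
  show False
  proof (rule no_three_disjoint_arcs_in_line[of "\<epsilon> / 2" \<phi> "Im (e * f z)"])
    show "\<epsilon> / 2 > 0" using q(1) by simp
    show "\<phi> k 0 = Im (e * f z)" for k by (simp add: \<phi>_def ray_def q(4))
    show "continuous_on {0..\<epsilon> / 2} (\<phi> k)" for k
    proof -
      have "continuous_on {0..\<epsilon> / 2} (ray k)" unfolding ray_def by (intro continuous_intros)
      then have "continuous_on {0..\<epsilon> / 2} (\<lambda>t. q (ray k t))"
        by (rule continuous_on_compose2[OF q(2)]) (use ray in auto)
      then have "continuous_on {0..\<epsilon> / 2} (\<lambda>t. f (q (ray k t)))"
        by (rule continuous_on_compose2[OF fcont]) (use inU in auto)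
      then show ?thesis unfolding \<phi>_def by (intro continuous_intros)
    qed
    fix j k :: nat and s t :: real
    assume jk: "j < 3" "k < 3" and s: "0 \<le> s" "s \<le> \<epsilon> / 2" and t: "0 < t" "t \<le> \<epsilon> / 2"
      and eq: "\<phi> j s = \<phi> k t"
    have "e * f (q (ray j s)) = e * f (q (ray k t))"
      using eq level[OF s, of j] level[of t k] t by (simp add: complex_eq_iff \<phi>_def)
    then have "f (q (ray j s)) = f (q (ray k t))" using e0 by simp
    then have "q (ray j s) = q (ray k t)"
      using inj_onD[OF assms(4)] inU[OF s, of j] inU[of t k] t r(2) by (metis less_imp_le subsetD)
    then have *: "ray j s = ray k t"
      using inj_onD[OF q(3)] ray[OF s, of j] ray[of t k] t by (metis less_imp_le)
    then have "cmod (ray j s) = cmod (ray k t)" by simp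
    then have st: "s = t" using s t by (simp add: ray_def norm_mult)
    with * t have "cis (\<theta> j) = cis (\<theta> k)" by (simp add: ray_def)
    then have "exp (\<i> * \<theta> j) = exp (\<i> * \<theta> k)" by (simp add: cis_conv_exp)
    moreover have "\<bar>\<theta> j - \<theta> k\<bar> < 2 * pi"
    proof -
      have "0 \<le> \<theta> i \<and> \<theta> i < 2 * pi" if "i < 3" for i
      proof -
        have "2 * real i + 1 < 4 * real n" using that q(6) by linarith
        then have "(2 * real i + 1) * pi < 4 * real n * pi" by (intro mult_strict_right_mono) auto
        then show ?thesis using q(6) by (simp add: \<theta>_def field_simps)
      qed
      from this[OF jk(1)] this[OF jk(2)] show ?thesis by linarith
    qed
    ultimately have "\<i> * \<theta> j = \<i> * \<theta> k" using exp_complex_eqI[of "\<i> * \<theta> j" "\<i> * \<theta> k"] by simp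
    then have "\<theta> j = \<theta> k" by simp
    then have "j = k" using q(6) by (simp add: \<theta>_def)
    with st show "j = k \<and> s = t" by simp
  qed
qed

section \<open>Almost extremal maps of the right half-plane\<close>

text \<open>In polar coordinates the two components are \<open>r powr (1 + m) * cos ((1 + m) * \<theta>)\<close> and
  \<open>r powr (2 + m) * sin ((2 + m) * \<theta>)\<close>. For \<open>m = 0\<close> the map is \<open>x + 2 \<i> x y\<close>, which is injective on the
  right half-plane, has a Jacobian proportional to the distance from the boundary (this produces
  the Schwarzian norm \<open>3 / 2\<close>), and collapses the whole boundary line to one point. For small
  \<open>m > 0\<close> the two boundary rays are pulled past each other and injectivity is lost, while the
  Schwarzian changes little.\<close>

definition wedge_map :: "real \<Rightarrow> complex \<Rightarrow> complex" where
  "wedge_map m s = of_real (Re (s * s powr m)) + \<i> * of_real (Im (s\<^sup>2 * s powr m))"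

text \<open>Put \<open>v = 1 + cnj s / s\<close>, so that \<open>s * v = 2 * Re s\<close> and \<open>|v| \<le> 2\<close>. The Jacobian is a constant
  multiple of \<open>|s powr m|\<^sup>2 * Re s\<close>, hence the pre-Schwarzian is \<open>m / s + 1 / (s * v)\<close>, and
  \<open>- S * (s * v)\<^sup>2\<close> is the polynomial \<open>3 / 2 + m * v + (m + m\<^sup>2 / 2) * v\<^sup>2\<close>.\<close>

lemma wedge_map_facts:
  fixes m :: real
  assumes "m \<ge> 0"
  defines "H \<equiv> {s::complex. Re s > 0}"
  shows "harmonic_on (wedge_map m) H"
    and "s \<in> H \<Longrightarrow> jacobian (wedge_map m) s \<noteq> 0"
    and "s \<in> H \<Longrightarrow> cmod (schwarzian (wedge_map m) s) * (2 * Re s)\<^sup>2 \<le> 3 / 2 + 6 * m + 2 * m\<^sup>2"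
proof -
  define M where "M = complex_of_real m"
  define e where "e = (\<lambda>s::complex. s powr M)"
  define p where "p = (\<lambda>s::complex. (1 + M) * e s)"
  define q where "q = (\<lambda>s. (2 + M) * s * e s)"
  define a where "a = (\<lambda>s::complex. (p s + q s) / 2)"
  define b where "b = (\<lambda>s. (p s - q s) / 2)"
  have H: "open H" unfolding H_def by (rule open_halfspace_Re_gt)
  have nz: "s \<noteq> 0" "e s \<noteq> 0" if "s \<in> H" for s using that by (auto simp: H_def e_def)
  have de: "(e has_field_derivative M * e s / s) (at s)" if "s \<in> H" for s
  proof -
    have "s \<notin> \<real>\<^sub>\<le>\<^sub>0" using that by (auto simp: H_def complex_nonpos_Reals_iff)
    from has_field_derivative_powr[OF this, of M] nz[OF that] show ?thesis
      by (simp add: e_def powr_diff)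
  qed
  have dp: "(p has_field_derivative (1 + M) * M * e s / s) (at s)" if "s \<in> H" for s
    unfolding p_def using de[OF that] nz[OF that] by (auto intro!: derivative_eq_intros simp: field_simps)
  have dq: "(q has_field_derivative (2 + M) * (1 + M) * e s) (at s)" if "s \<in> H" for s
    unfolding q_def using nz[OF that] by (auto intro!: derivative_eq_intros de[OF that] simp: field_simps)
  have dp2: "((\<lambda>s. (1 + M) * M * e s / s) has_field_derivative (1 + M) * M * (M - 1) * e s / s\<^sup>2) (at s)"
    if "s \<in> H" for s
    using nz[OF that] by (auto intro!: derivative_eq_intros de[OF that] simp: field_simps power2_eq_square)
  have dq2: "((\<lambda>s. (2 + M) * (1 + M) * e s) has_field_derivative (2 + M) * (1 + M) * M * e s / s) (at s)"
    if "s \<in> H" for s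
    using nz[OF that] by (auto intro!: derivative_eq_intros de[OF that] simp: field_simps)
  have ev: "eventually (\<lambda>w. w \<in> H) (nhds s)" if "s \<in> H" for s
    using H that by (rule eventually_nhds_in_open)
  have da: "(a has_field_derivative ((1 + M) * M * e s / s + (2 + M) * (1 + M) * e s) / 2) (at s)"
    if "s \<in> H" for s
    unfolding a_def by (intro DERIV_cdivide DERIV_add dp dq that)
  have db: "(b has_field_derivative ((1 + M) * M * e s / s - (2 + M) * (1 + M) * e s) / 2) (at s)"
    if "s \<in> H" for s
    unfolding b_def by (intro DERIV_cdivide DERIV_diff dp dq that)
  note da1 = da[THEN DERIV_imp_deriv] and db1 = db[THEN DERIV_imp_deriv]
  have da2: "deriv (deriv a) s = ((1 + M) * M * (M - 1) * e s / s\<^sup>2 + (2 + M) * (1 + M) * M * e s / s) / 2"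
    if "s \<in> H" for s
  proof -
    have "deriv (deriv a) s = deriv (\<lambda>s. ((1 + M) * M * e s / s + (2 + M) * (1 + M) * e s) / 2) s"
      by (rule deriv_cong_ev[OF eventually_mono[OF ev[OF that]]]) (simp_all add: da1)
    also have "\<dots> = ((1 + M) * M * (M - 1) * e s / s\<^sup>2 + (2 + M) * (1 + M) * M * e s / s) / 2"
      by (intro DERIV_imp_deriv DERIV_cdivide DERIV_add dp2 dq2 that)
    finally show ?thesis .
  qed
  have db2: "deriv (deriv b) s = ((1 + M) * M * (M - 1) * e s / s\<^sup>2 - (2 + M) * (1 + M) * M * e s / s) / 2"
    if "s \<in> H" for s
  proof -
    have "deriv (deriv b) s = deriv (\<lambda>s. ((1 + M) * M * e s / s - (2 + M) * (1 + M) * e s) / 2) s"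
      by (rule deriv_cong_ev[OF eventually_mono[OF ev[OF that]]]) (simp_all add: db1)
    also have "\<dots> = ((1 + M) * M * (M - 1) * e s / s\<^sup>2 - (2 + M) * (1 + M) * M * e s / s) / 2"
      by (intro DERIV_imp_deriv DERIV_cdivide DERIV_diff dp2 dq2 that)
    finally show ?thesis .
  qed
  have form: "harmonic_form (wedge_map m) a b H"
    unfolding harmonic_form_def
  proof (intro conjI ballI)
    show "a holomorphic_on H" "b holomorphic_on H"
      using da db by (meson holomorphic_onI field_differentiable_at_within field_differentiable_def)+
    fix s assume s: "s \<in> H"
    have X: "((\<lambda>s. s * e s) has_field_derivative p s) (at s)"
      unfolding p_def using nz[OF s] by (auto intro!: derivative_eq_intros de[OF s] simp: field_simps)
    have Y: "((\<lambda>s. s\<^sup>2 * e s) has_field_derivative q s) (at s)"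
      unfolding q_def using nz[OF s]
      by (auto intro!: derivative_eq_intros de[OF s] simp: field_simps power2_eq_square)
    have "wedge_map m = (\<lambda>s. (1/2) * ((s * e s + cnj (s * e s)) + (s\<^sup>2 * e s - cnj (s\<^sup>2 * e s))))"
    proof -
      have "of_real (Re X) + \<i> * of_real (Im Y) = (1/2) * ((X + cnj X) + (Y - cnj Y))" for X Y
        by (simp add: complex_eq_iff)
      then show ?thesis by (simp only: wedge_map_def e_def M_def fun_eq_iff) simp
    qed
    moreover have "has_wirtinger \<dots> ((1/2) * ((p s + 0) + (q s - 0)) + 0 * ((s * e s + cnj (s * e s)) + (s\<^sup>2 * e s - cnj (s\<^sup>2 * e s))))
       ((1/2) * ((0 + cnj (p s)) + (0 - cnj (q s))) + 0 * ((s * e s + cnj (s * e s)) + (s\<^sup>2 * e s - cnj (s\<^sup>2 * e s)))) s"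
      using has_wirtinger_cnj[OF has_wirtinger_holomorphic[OF X]]
        has_wirtinger_cnj[OF has_wirtinger_holomorphic[OF Y]]
      by (intro has_wirtinger_mult has_wirtinger_add has_wirtinger_diff has_wirtinger_holomorphic[OF X]
          has_wirtinger_holomorphic[OF Y] has_wirtinger_holomorphic[OF DERIV_const]) simp_all
    ultimately show "has_wirtinger (wedge_map m) (a s) (cnj (b s)) s"
      by (simp add: a_def b_def)
  qed
  show "harmonic_on (wedge_map m) H" by (rule harmonic_form_imp_harmonic_on[OF H form])
  define K where "K = (\<lambda>s. (1 + M) * (2 + M) * (e s * cnj (e s)) / 2)"
  have cM: "cnj M = M" by (simp add: M_def)
  have K: "K s \<noteq> 0" if "s \<in> H" for s
  proof -
    have "1 + M \<noteq> 0" "2 + M \<noteq> 0" using assms(1) by (auto simp: M_def complex_eq_iff)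
    then show ?thesis using nz[OF that] by (simp add: K_def)
  qed
  have J: "complex_of_real (jacobian (wedge_map m) s) = K s * (s + cnj s)" if "s \<in> H" for s
    unfolding of_real_jacobian_harmonic_form[OF form that] a_def b_def p_def q_def K_def
    by (simp add: field_simps cM)
  have sum: "s + cnj s \<noteq> 0" if "s \<in> H" for s
    using that by (simp add: H_def complex_add_cnj)
  show Jnz: "jacobian (wedge_map m) s \<noteq> 0" if "s \<in> H" for s
    using J[OF that] K[OF that] sum[OF that] by auto
  show "cmod (schwarzian (wedge_map m) s) * (2 * Re s)\<^sup>2 \<le> 3 / 2 + 6 * m + 2 * m\<^sup>2" if s: "s \<in> H"
  proof -
    define u where "u = cnj s / s"
    define v where "v = 1 + u"
    have s0: "s \<noteq> 0" using nz[OF s] by simp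
    have cs: "cnj s = u * s" using s0 by (simp add: u_def)
    have N1: "deriv a s * cnj (a s) - deriv b s * cnj (b s) = K s * (M * u + (1 + M))"
      unfolding da1[OF s] db1[OF s] unfolding a_def b_def p_def q_def K_def
      using s0 by (simp add: cs cM field_simps)
    have N2: "deriv (deriv a) s * cnj (a s) - deriv (deriv b) s * cnj (b s)
        = K s * (M * (M - 1) * u + M * (M + 1)) / s"
      unfolding da2[OF s] db2[OF s] unfolding a_def b_def p_def q_def K_def
      using s0 by (simp add: cs cM field_simps power2_eq_square)
    have sv: "s + cnj s = s * v" by (simp add: cs v_def algebra_simps)
    have v0: "v \<noteq> 0" using sum[OF s] sv by auto
    have S: "schwarzian (wedge_map m) s =
        (M * (M - 1) * u + M * (M + 1)) / (s\<^sup>2 * v) - 3 / 2 * ((M * u + (1 + M)) / (s * v))\<^sup>2"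
      by (subst schwarzian_harmonic_form[OF H form _ s])
        (use Jnz K[OF s] s0 v0 in \<open>simp_all add: N1 N2 J[OF s] sv power2_eq_square\<close>)
    have "schwarzian (wedge_map m) s * (s * v)\<^sup>2
        = v * (M * (M - 1) * u + M * (M + 1)) - 3 / 2 * (M * u + (1 + M))\<^sup>2"
      unfolding S using s0 v0 by (simp add: field_simps power2_eq_square)
    also have "\<dots> = - (3 / 2 + M * v + (M + M\<^sup>2 / 2) * v\<^sup>2)"
      unfolding v_def by (simp add: field_simps power2_eq_square)
    finally have eq: "schwarzian (wedge_map m) s * (s * v)\<^sup>2 = - (3 / 2 + M * v + (M + M\<^sup>2 / 2) * v\<^sup>2)" .
    have "cmod (s * v) = 2 * Re s"
      using s unfolding sv[symmetric] by (simp add: complex_add_cnj H_def)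
    then have "cmod (schwarzian (wedge_map m) s) * (2 * Re s)\<^sup>2 = cmod (schwarzian (wedge_map m) s * (s * v)\<^sup>2)"
      by (simp add: norm_mult norm_power)
    also have "\<dots> = cmod (3 / 2 + of_real m * v + of_real (m + m\<^sup>2 / 2) * v\<^sup>2)"
      unfolding eq by (subst norm_minus_cancel) (simp add: M_def)
    also have "\<dots> \<le> cmod (3 / 2) + cmod (of_real m * v) + cmod (of_real (m + m\<^sup>2 / 2) * v\<^sup>2)"
      by (intro norm_triangle_mono norm_triangle_ineq) simp
    also have "\<dots> = 3 / 2 + m * cmod v + (m + m\<^sup>2 / 2) * (cmod v)\<^sup>2"
      using assms(1) by (simp only: norm_mult norm_power norm_of_real) simp
    also have "\<dots> \<le> 3 / 2 + m * 2 + (m + m\<^sup>2 / 2) * 2\<^sup>2"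
    proof -
      have "cmod v \<le> cmod 1 + cmod u" unfolding v_def by (rule norm_triangle_ineq)
      also have "cmod u = 1" using s0 by (simp add: u_def norm_divide)
      finally have "cmod v \<le> 2" by simp
      then show ?thesis using assms(1) by (intro add_mono mult_left_mono power_mono order_refl) auto
    qed
    also have "\<dots> = 3 / 2 + 6 * m + 2 * m\<^sup>2" by simp
    finally show ?thesis .
  qed
qed

text \<open>At the angles \<open>\<plusminus>\<theta>\<close> the second component vanishes because \<open>(2 + m) * \<theta> = \<pi>\<close>, and the first one
  is even; both angles are in the half-plane as soon as \<open>m > 0\<close>.\<close>

lemma wedge_map_not_injective:
  fixes m :: real
  assumes "m > 0"
  defines "\<theta> \<equiv> pi / (2 + m)"
  shows "Re (cis \<theta>) > 0" "Re (cis (- \<theta>)) > 0" "cis \<theta> \<noteq> cis (- \<theta>)"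
    "wedge_map m (cis \<theta>) = wedge_map m (cis (- \<theta>))"
proof -
  have \<theta>: "0 < \<theta>" "\<theta> < pi / 2" using assms pi_gt_zero by (auto simp: \<theta>_def field_simps)
  show "Re (cis \<theta>) > 0" "Re (cis (- \<theta>)) > 0" using \<theta> by (auto intro: cos_gt_zero)
  have "sin \<theta> > 0" using \<theta> by (intro sin_gt_zero) auto
  then show "cis \<theta> \<noteq> cis (- \<theta>)" by (simp add: complex_eq_iff)
  have powr: "cis x powr m = cis (m * x)" if "\<bar>x\<bar> < pi" for x
  proof -
    have "Ln (cis x) = x * \<i>" using that by (intro Ln_cis) auto
    then show ?thesis by (simp add: powr_def cis_conv_exp algebra_simps)
  qed
  have val: "wedge_map m (cis x) = of_real (cos ((1 + m) * x)) + \<i> * of_real (sin ((2 + m) * x))"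
    if "\<bar>x\<bar> < pi" for x
  proof -
    have "cis x * cis (m * x) = cis ((1 + m) * x)" "(cis x)\<^sup>2 * cis (m * x) = cis ((2 + m) * x)"
      by (simp_all add: cis_mult power2_eq_square algebra_simps)
    then show ?thesis unfolding wedge_map_def powr[OF that] by simp
  qed
  have "(2 + m) * \<theta> = pi" using assms by (simp add: \<theta>_def)
  then show "wedge_map m (cis \<theta>) = wedge_map m (cis (- \<theta>))"
    using \<theta> by (simp add: val)
qed

section \<open>Automorphisms of the disc and the Schwarz--Pick lemma\<close>

lemma Moebius_denominator_nonzero:
  assumes "cmod w < 1" "cmod z < 1"
  shows "1 - cnj w * z \<noteq> 0"
proof -
  have "cmod (cnj w * z) < 1" using norm_mult_less[of "cnj w" 1 z 1] assms by simp
  then show ?thesis by auto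
qed

text \<open>Automorphisms of the disc are isometries of the hyperbolic metric.\<close>

lemma Moebius_function_pointwise_metric:
  assumes "cmod w < 1" "cmod z < 1"
  shows "(Moebius_function t w has_field_derivative deriv (Moebius_function t w) z) (at z)"
    and "cmod (deriv (Moebius_function t w) z) * (1 - (cmod z)\<^sup>2) = 1 - (cmod (Moebius_function t w z))\<^sup>2"
proof -
  define e where "e = exp (\<i> * of_real t)"
  have e: "cmod e = 1" by (simp add: e_def)
  have M: "Moebius_function t w x = (e * x + - e * w) / (- cnj w * x + 1)" for x
    by (simp add: Moebius_function_def e_def algebra_simps)
  have nz: "- cnj w * x + 1 \<noteq> 0" if "x \<in> ball 0 1" for x
    using Moebius_denominator_nonzero[OF assms(1), of x] that by simp
  have z: "z \<in> ball 0 1" using assms(2) by simp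
  have d: "(Moebius_function t w has_field_derivative (e * 1 - - e * w * - cnj w) / (- cnj w * z + 1)\<^sup>2) (at z)"
    "deriv (Moebius_function t w) z = (e * 1 - - e * w * - cnj w) / (- cnj w * z + 1)\<^sup>2"
    using mobius_derivs[OF open_ball nz z M] by blast+
  show "(Moebius_function t w has_field_derivative deriv (Moebius_function t w) z) (at z)"
    using d by simp
  have num: "e * 1 - - e * w * - cnj w = e * of_real (1 - (cmod w)\<^sup>2)"
    unfolding of_real_diff of_real_1 complex_norm_square by (simp add: algebra_simps)
  have w1: "0 \<le> 1 - (cmod w)\<^sup>2" using assms(1) by (simp add: power_le_one)
  have n: "cmod (- cnj w * z + 1) \<noteq> 0" using nz[OF z] by simp
  have "complex_of_real ((cmod (- cnj w * z + 1))\<^sup>2 - (cmod (z - w))\<^sup>2)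
      = of_real ((1 - (cmod w)\<^sup>2) * (1 - (cmod z)\<^sup>2))"
    unfolding of_real_diff of_real_mult complex_norm_square of_real_1 by (simp add: algebra_simps)
  then have id: "(cmod (- cnj w * z + 1))\<^sup>2 - (cmod (z - w))\<^sup>2 = (1 - (cmod w)\<^sup>2) * (1 - (cmod z)\<^sup>2)"
    by (simp only: of_real_eq_iff)
  have Mn: "cmod (Moebius_function t w z) = cmod (z - w) / cmod (- cnj w * z + 1)"
    by (simp add: Moebius_function_def norm_divide norm_mult)
  have "cmod (deriv (Moebius_function t w) z) * (1 - (cmod z)\<^sup>2)
     = (1 - (cmod w)\<^sup>2) * (1 - (cmod z)\<^sup>2) / (cmod (- cnj w * z + 1))\<^sup>2"
    unfolding d(2) num norm_divide norm_mult norm_power norm_of_real using w1 e by simp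
  also have "\<dots> = 1 - (cmod (Moebius_function t w z))\<^sup>2"
    unfolding id[symmetric] Mn using n by (simp add: field_simps)
  finally show "cmod (deriv (Moebius_function t w) z) * (1 - (cmod z)\<^sup>2)
      = 1 - (cmod (Moebius_function t w z))\<^sup>2" .
qed

text \<open>The Schwarz lemma, applied after \<open>z\<close> and \<open>q z\<close> have been moved to the origin by automorphisms.\<close>

lemma Schwarz_Pick:
  assumes "q holomorphic_on ball 0 1" "q ` ball 0 1 \<subseteq> ball 0 1" "z \<in> ball 0 1"
  shows "cmod (deriv q z) * (1 - (cmod z)\<^sup>2) \<le> 1 - (cmod (q z))\<^sup>2"
proof -
  define g where "g = (\<lambda>x. Moebius_function 0 (q z) (q (Moebius_function 0 (- z) x)))"
  have n: "cmod z < 1" "cmod (- z) < 1" "cmod (q z) < 1"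
    using assms(2,3) by (auto simp: image_subset_iff)
  have qn: "cmod (q x) < 1" if "cmod x < 1" for x using assms(2) that by (auto simp: image_subset_iff)
  have M: "cmod (Moebius_function 0 (- z) x) < 1" if "cmod x < 1" for x
    using Moebius_function_norm_lt_1[OF n(2) that] .
  have M0: "Moebius_function 0 (- z) 0 = z" by (simp add: Moebius_function_def)
  have "(\<lambda>x. q (Moebius_function 0 (- z) x)) holomorphic_on ball 0 1"
    by (rule holomorphic_on_compose_gen[OF Moebius_function_holomorphic[OF n(2)] assms(1), unfolded o_def])
      (use M in auto)
  then have ghol: "g holomorphic_on ball 0 1"
    unfolding g_def
    by (rule holomorphic_on_compose_gen[OF _ Moebius_function_holomorphic[OF n(3)], unfolded o_def])
      (use M qn in auto)
  have g0: "g 0 = 0" by (simp add: g_def M0 Moebius_function_eq_zero)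
  have gn: "cmod (g x) < 1" if "cmod x < 1" for x
    unfolding g_def using Moebius_function_norm_lt_1[OF n(3)] qn M that by blast
  have "cmod (deriv g 0) \<le> 1" using Schwarz_Lemma(2)[OF ghol g0 gn, of 0] by simp
  have d1: "(Moebius_function 0 (- z) has_field_derivative deriv (Moebius_function 0 (- z)) 0) (at 0)"
    "cmod (deriv (Moebius_function 0 (- z)) 0) = 1 - (cmod z)\<^sup>2"
    using Moebius_function_pointwise_metric[OF n(2), of 0 0] by (simp_all add: M0)
  have d2: "(Moebius_function 0 (q z) has_field_derivative deriv (Moebius_function 0 (q z)) (q z)) (at (q z))"
    "cmod (deriv (Moebius_function 0 (q z)) (q z)) * (1 - (cmod (q z))\<^sup>2) = 1"
    using Moebius_function_pointwise_metric[OF n(3,3), of 0] by (simp_all add: Moebius_function_eq_zero)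
  have dq: "(q has_field_derivative deriv q z) (at z)"
    using assms by (intro holomorphic_derivI[of _ "ball 0 1"]) auto
  have "((\<lambda>x. q (Moebius_function 0 (- z) x)) has_field_derivative
      deriv q z * deriv (Moebius_function 0 (- z)) 0) (at 0)"
    by (rule DERIV_chain2[OF _ d1(1)]) (simp add: M0 dq)
  then have "(g has_field_derivative deriv (Moebius_function 0 (q z)) (q z) *
      (deriv q z * deriv (Moebius_function 0 (- z)) 0)) (at 0)"
    unfolding g_def by (rule DERIV_chain2[rotated]) (simp add: M0 d2(1))
  then have "deriv g 0 = deriv (Moebius_function 0 (q z)) (q z) *
      (deriv q z * deriv (Moebius_function 0 (- z)) 0)"
    by (rule DERIV_imp_deriv)
  then have g': "cmod (deriv (Moebius_function 0 (q z)) (q z)) * (cmod (deriv q z) * (1 - (cmod z)\<^sup>2)) \<le> 1"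
    using \<open>cmod (deriv g 0) \<le> 1\<close> by (simp add: norm_mult d1(2))
  define k where "k = cmod (deriv (Moebius_function 0 (q z)) (q z))"
  have k: "k * (1 - (cmod (q z))\<^sup>2) = 1" using d2(2) by (simp add: k_def)
  have pos: "1 - (cmod (q z))\<^sup>2 > 0" using n(3) by (simp add: power_less_one_iff)
  have "k * (cmod (deriv q z) * (1 - (cmod z)\<^sup>2)) \<le> k * (1 - (cmod (q z))\<^sup>2)"
    using g' k by (simp add: k_def)
  moreover have "k > 0" using k pos by (metis zero_less_mult_pos2 zero_less_one)
  ultimately show ?thesis by simp
qed

section \<open>Noninjective maps of the disc with small Schwarzian\<close>

text \<open>A witness that \<open>c\<close> is too large for the disc, phrased without the sphere: \<open>1 / (1 - |z|\<^sup>2)\<close> is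
  the hyperbolic density of the disc, and a nonvanishing Jacobian stands for local univalence. The
  two points with the same image are recorded because they will have to be moved into the image of a
  given domain.\<close>

definition disc_counterexample :: "real \<Rightarrow> (complex \<Rightarrow> complex) \<Rightarrow> complex \<Rightarrow> complex \<Rightarrow> bool" where
  "disc_counterexample c f z\<^sub>1 z\<^sub>2 \<longleftrightarrow>
     harmonic_on f (ball 0 1) \<and>
     (\<forall>z\<in>ball 0 1. jacobian f z \<noteq> 0 \<and> cmod (schwarzian f z) * (1 - (cmod z)\<^sup>2)\<^sup>2 \<le> c) \<and>
     z\<^sub>1 \<in> ball 0 1 \<and> z\<^sub>2 \<in> ball 0 1 \<and> z\<^sub>1 \<noteq> z\<^sub>2 \<and> f z\<^sub>1 = f z\<^sub>2"

text \<open>Both \<open>S\<^sub>f\<close> and the squared hyperbolic density pick up the factor \<open>|T'|\<^sup>2\<close>, so their quotient is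
  invariant.\<close>

lemma disc_counterexample_Moebius:
  assumes "disc_counterexample c f (Moebius_function t w z\<^sub>1) (Moebius_function t w z\<^sub>2)"
    and "cmod w < 1" "z\<^sub>1 \<in> ball 0 1" "z\<^sub>2 \<in> ball 0 1"
  shows "disc_counterexample c (\<lambda>z. f (Moebius_function t w z)) z\<^sub>1 z\<^sub>2"
proof -
  define T where "T = Moebius_function t w"
  define e where "e = exp (\<i> * of_real t)"
  have T: "T x = (e * x + - e * w) / (- cnj w * x + 1)" for x
    by (simp add: T_def Moebius_function_def e_def algebra_simps)
  have nz: "- cnj w * x + 1 \<noteq> 0" if "x \<in> ball 0 1" for x
    using Moebius_denominator_nonzero[OF assms(2), of x] that by simp
  have "(cmod w)\<^sup>2 < 1" using assms(2) by (simp add: power_less_one_iff)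
  moreover have "e * 1 - - e * w * - cnj w = e * of_real (1 - (cmod w)\<^sup>2)"
    unfolding of_real_diff of_real_1 complex_norm_square by (simp add: algebra_simps)
  ultimately have det: "e * 1 - - e * w * - cnj w \<noteq> 0"
    by (simp only: mult_eq_0_iff of_real_eq_0_iff) (simp add: e_def)
  have f: "harmonic_on f (ball 0 1)" "\<And>z. z \<in> ball 0 1 \<Longrightarrow> jacobian f z \<noteq> 0"
    "\<And>z. z \<in> ball 0 1 \<Longrightarrow> cmod (schwarzian f z) * (1 - (cmod z)\<^sup>2)\<^sup>2 \<le> c"
    using assms(1) by (auto simp: disc_counterexample_def)
  have im: "T x \<in> ball 0 1" if "x \<in> ball 0 1" for x
    unfolding T_def using Moebius_function_norm_lt_1[OF assms(2), of x] that by simp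
  have im': "T ` ball 0 1 \<subseteq> ball 0 1" using im by blast
  have comp: "harmonic_on (\<lambda>z. f (T z)) (ball 0 1)"
    "\<And>z. z \<in> ball 0 1 \<Longrightarrow> jacobian (\<lambda>z. f (T z)) z \<noteq> 0"
    "\<And>z. z \<in> ball 0 1 \<Longrightarrow> schwarzian (\<lambda>z. f (T z)) z = schwarzian f (T z) * (deriv T z)\<^sup>2"
    using schwarzian_comp_mobius[OF open_ball open_ball f(1) _ _ _ det im'] f(2) T nz by blast+
  have "cmod (schwarzian (\<lambda>z. f (T z)) z) * (1 - (cmod z)\<^sup>2)\<^sup>2 \<le> c" if z: "z \<in> ball 0 1" for z
  proof -
    have "cmod (deriv T z) * (1 - (cmod z)\<^sup>2) = 1 - (cmod (T z))\<^sup>2"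
      unfolding T_def using Moebius_function_pointwise_metric(2)[OF assms(2)] z by simp
    then have "(1 - (cmod (T z))\<^sup>2)\<^sup>2 = (cmod (deriv T z))\<^sup>2 * (1 - (cmod z)\<^sup>2)\<^sup>2"
      by (simp add: power_mult_distrib flip: \<open>cmod (deriv T z) * (1 - (cmod z)\<^sup>2) = 1 - (cmod (T z))\<^sup>2\<close>)
    then show ?thesis
      using f(3)[OF im[OF z]] by (simp add: comp(3)[OF z] norm_mult norm_power mult.assoc)
  qed
  moreover have "z\<^sub>1 \<noteq> z\<^sub>2" "f (T z\<^sub>1) = f (T z\<^sub>2)"
    using assms(1) by (auto simp: disc_counterexample_def T_def)
  ultimately show ?thesis
    using comp(1,2) assms(3,4) by (simp add: disc_counterexample_def T_def)
qed

section \<open>Topology of the sphere and inversions\<close>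

lemma open_Fin_vimage: "open S \<Longrightarrow> open (Fin -` S)" and open_recip_vimage: "open S \<Longrightarrow> open (recip_chart -` S)"
  for S :: "sphere set"
  by (simp_all add: open_sphere_def)

lemma open_nonInfty: "open (- {Infty})"
proof -
  have "Fin -` (- {Infty}) = UNIV" "recip_chart -` (- {Infty}) = - {0}"
    by (auto simp: recip_chart_def)
  then show ?thesis by (simp add: open_sphere_def open_Compl)
qed

lemma open_nonzero: "open (- {Fin 0})"
proof -
  have "Fin -` (- {Fin 0}) = - {0}" "recip_chart -` (- {Fin 0}) = UNIV"
    by (auto simp: recip_chart_def)
  then show ?thesis by (simp add: open_sphere_def open_Compl)
qed

lemma open_Fin_image: "open U \<Longrightarrow> open (Fin ` U)"
proof -
  assume U: "open U"
  have "Fin -` Fin ` U = U" by auto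
  moreover have "recip_chart -` Fin ` U = (- {0}) \<inter> (\<lambda>\<zeta>. 1 / \<zeta>) -` U"
    by (auto simp: recip_chart_def split: if_splits)
  moreover have "open ((- {0}) \<inter> (\<lambda>\<zeta>::complex. 1 / \<zeta>) -` U)"
    using U by (intro continuous_open_preimage) (auto intro!: continuous_intros)
  ultimately show ?thesis using U by (simp add: open_sphere_def)
qed

lemma open_sphere_contains_Fin:
  assumes "open S" "S \<noteq> {}"
  obtains z where "Fin z \<in> S"
proof -
  from assms(2) obtain p where p: "p \<in> S" by blast
  show thesis
  proof (cases p)
    case (Fin z)
    with p that show thesis by blast
  next
    case Infty
    then have "0 \<in> recip_chart -` S" using p by (simp add: recip_chart_def)
    then obtain d where d: "d > 0" "ball 0 d \<subseteq> recip_chart -` S"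
      using open_recip_vimage[OF assms(1)] openE by blast
    have "complex_of_real (d / 2) \<in> ball 0 d" using d(1) by simp
    then have "recip_chart (of_real (d / 2)) \<in> S" using d(2) by blast
    then have "Fin (1 / of_real (d / 2)) \<in> S" using d(1) by (simp add: recip_chart_def)
    then show thesis by (rule that)
  qed
qed

lemma Fin_continuous: "continuous_on A Fin"
  by (rule continuous_on_subset[of UNIV]) (auto simp: continuous_on_open_vimage open_Fin_vimage)

text \<open>A Moebius map with pole at \<open>c\<close>. For \<open>R > 0\<close> it maps the complement in the sphere of the closed disc of
  radius \<open>R\<close> about \<open>c\<close> onto the unit disc.\<close>

fun inversion :: "complex \<Rightarrow> real \<Rightarrow> sphere \<Rightarrow> complex" where
  "inversion c R (Fin z) = of_real R / (z - c)"
| "inversion c R Infty = 0"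

lemma inversion_recip_chart:
  assumes "recip_chart \<zeta> \<noteq> Fin c"
  shows "inversion c R (recip_chart \<zeta>) = of_real R * \<zeta> / (1 - c * \<zeta>)" and "1 - c * \<zeta> \<noteq> 0"
proof -
  show nz: "1 - c * \<zeta> \<noteq> 0"
  proof
    assume "1 - c * \<zeta> = 0"
    then have "c * \<zeta> = 1" by simp
    then have "\<zeta> \<noteq> 0" by auto
    with \<open>c * \<zeta> = 1\<close> have "1 / \<zeta> = c" by (simp add: field_simps)
    with \<open>\<zeta> \<noteq> 0\<close> assms show False by (simp add: recip_chart_def)
  qed
  show "inversion c R (recip_chart \<zeta>) = of_real R * \<zeta> / (1 - c * \<zeta>)"
  proof (cases "\<zeta> = 0")
    case False
    then have "1 / \<zeta> - c = (1 - c * \<zeta>) / \<zeta>" by (simp add: field_simps)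
    with False nz show ?thesis by (simp add: recip_chart_def)
  qed (simp add: recip_chart_def)
qed

lemma inversion_inj: "R \<noteq> 0 \<Longrightarrow> Fin c \<notin> \<Omega> \<Longrightarrow> inj_on (inversion c R) \<Omega>"
proof (rule inj_onI)
  fix p q assume "R \<noteq> 0" "Fin c \<notin> \<Omega>" "p \<in> \<Omega>" "q \<in> \<Omega>" "inversion c R p = inversion c R q"
  then show "p = q" by (cases p; cases q) (auto simp: field_simps)
qed

lemma inversion_vimage_open:
  assumes "open \<Omega>" "Fin c \<notin> \<Omega>" "open W"
  shows "open (inversion c R -` W \<inter> \<Omega>)"
proof -
  have 1: "Fin -` (inversion c R -` W \<inter> \<Omega>) = (Fin -` \<Omega>) \<inter> (\<lambda>z. of_real R / (z - c)) -` W" by auto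
  have ne: "z \<noteq> c" if "z \<in> Fin -` \<Omega>" for z using that assms(2) by auto
  have ne': "recip_chart \<zeta> \<noteq> Fin c" if "\<zeta> \<in> recip_chart -` \<Omega>" for \<zeta> using that assms(2) by auto
  have 2: "recip_chart -` (inversion c R -` W \<inter> \<Omega>)
      = (recip_chart -` \<Omega>) \<inter> (\<lambda>\<zeta>. of_real R * \<zeta> / (1 - c * \<zeta>)) -` W"
    using inversion_recip_chart(1)[OF ne'] by auto
  show ?thesis
    unfolding open_sphere_def 1 2
    using assms ne inversion_recip_chart(2)[OF ne']
    by (intro conjI continuous_open_preimage) (auto intro!: continuous_intros open_Fin_vimage open_recip_vimage)
qed

lemma inversion_continuous:
  assumes "open \<Omega>" "Fin c \<notin> \<Omega>"
  shows "continuous_on \<Omega> (inversion c R)"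
  unfolding continuous_on_open_vimage[OF assms(1)] using inversion_vimage_open[OF assms] by blast

section \<open>Bounds for the hyperbolic density\<close>

lemma covering_locally_injective:
  assumes "covering_space S p \<Omega>" "open S" "z \<in> S"
  obtains T where "open T" "z \<in> T" "T \<subseteq> S" "inj_on p T"
proof -
  obtain T u q where T: "z \<in> T" "openin (top_of_set S) T" "homeomorphism T u p q"
    using covering_space_local_homeomorphism[OF assms(1,3)] by metis
  have "open T" "T \<subseteq> S" using T(2) assms(2) by (auto simp: openin_open_eq)
  moreover have "inj_on p T" using T(3) by (metis homeomorphism_apply1 inj_onI)
  ultimately show thesis using that T(1) by blast
qed

text \<open>A universal covering of \<open>\<Omega>\<close> followed by the inversion is a holomorphic self-map \<open>q\<close> of the disc, and
  the bound is the Schwarz--Pick lemma for \<open>q\<close>: hyperbolic metrics increase when domains shrink.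
  Holomorphy of \<open>q\<close> is checked in the two charts of the sphere. The derivative of the covering
  must not vanish, as otherwise the division by it would yield \<open>0\<close>.\<close>

lemma hyperbolic_density_ge:
  assumes "Fin c \<notin> \<Omega>" "\<And>p. p \<in> \<Omega> \<Longrightarrow> cmod (inversion c R p) < 1" "R > 0" "Fin w \<in> \<Omega>"
  shows "ennreal (R / (cmod (w - c))\<^sup>2 / (1 - (cmod (inversion c R (Fin w)))\<^sup>2)) \<le> hyperbolic_density \<Omega> w"
  unfolding hyperbolic_density_def
proof (rule Inf_greatest, elim CollectE exE conjE)
  fix x p z
  assume x: "x = ennreal (1 / ((1 - (cmod z)\<^sup>2) * cmod (deriv (fin_coord \<circ> p) z)))"
    and p: "universal_covering p \<Omega>" and "z \<in> ball 0 1" and pz: "p z = Fin w"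
  then have z: "cmod z < 1" by simp
  let ?B = "ball 0 1 :: complex set"
  have zB: "z \<in> ?B" using z by simp
  have hol: "continuous_on ?B p" "(fin_coord \<circ> p) holomorphic_on {z \<in> ?B. p z \<noteq> Infty}"
    "(recip_coord \<circ> p) holomorphic_on {z \<in> ?B. p z \<noteq> Fin 0}" and cov: "covering_space ?B p \<Omega>"
    using p by (auto simp: universal_covering_def sphere_holomorphic_on_def)
  have p\<Omega>: "p x \<in> \<Omega>" if "x \<in> ?B" for x using cov that by (auto simp: covering_space_def)
  define A where "A = {z \<in> ?B. p z \<noteq> Infty}"
  define A' where "A' = {z \<in> ?B. p z \<noteq> Fin 0}"
  have "A = ?B \<inter> p -` (- {Infty})" "A' = ?B \<inter> p -` (- {Fin 0})" by (auto simp: A_def A'_def)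
  then have openA: "open A" "open A'"
    using continuous_open_preimage[OF hol(1)] open_nonInfty open_nonzero by auto
  define P where "P = fin_coord \<circ> p"
  have P: "p x = Fin (P x)" if "x \<in> A" for x using that by (cases "p x") (auto simp: A_def P_def)
  have Pc: "P x \<noteq> c" if "x \<in> A" for x using P[OF that] p\<Omega>[of x] that assms(1) by (auto simp: A_def)
  define q where "q = (\<lambda>x. inversion c R (p x))"
  have q1: "q x = of_real R / (P x - c)" if "x \<in> A" for x using P[OF that] by (simp add: q_def)
  define Z where "Z = recip_coord \<circ> p"
  have pZ: "p x = recip_chart (Z x)" if "x \<in> A'" for x
    using that by (cases "p x") (auto simp: A'_def Z_def recip_chart_def)
  have pZc: "recip_chart (Z x) \<noteq> Fin c" if "x \<in> A'" for x
    using pZ[OF that] p\<Omega>[of x] that assms(1) by (auto simp: A'_def)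
  have q2: "q x = of_real R * Z x / (1 - c * Z x)" if "x \<in> A'" for x
    using pZ[OF that] inversion_recip_chart(1)[OF pZc[OF that]] by (simp add: q_def)
  have Phol: "P holomorphic_on A" using hol(2) by (simp add: P_def A_def)
  have Zhol: "Z holomorphic_on A'" using hol(3) by (simp add: Z_def A'_def)
  have "(\<lambda>x. of_real R / (P x - c)) holomorphic_on A"
    using Phol Pc by (intro holomorphic_intros) auto
  then have qA: "q holomorphic_on A" using q1 by (simp cong: holomorphic_cong)
  have "(\<lambda>x. of_real R * Z x / (1 - c * Z x)) holomorphic_on A'"
    using Zhol inversion_recip_chart(2)[OF pZc] by (intro holomorphic_intros) auto
  then have qA': "q holomorphic_on A'" using q2 by (simp cong: holomorphic_cong)
  have "?B = A \<union> A'" by (auto simp: A_def A'_def)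
  then have qhol: "q holomorphic_on ?B" using holomorphic_on_Un[OF qA qA' openA] by simp
  have qim: "q ` ?B \<subseteq> ?B" using assms(2) p\<Omega> by (auto simp: q_def)
  have zA: "z \<in> A" using zB pz by (simp add: A_def)
  have Pz: "P z = w" using P[OF zA] pz by simp
  have wc: "w \<noteq> c" using Pc[OF zA] Pz by simp
  have qz: "q z = inversion c R (Fin w)" by (simp add: q_def pz)
  have "(P has_field_derivative deriv P z) (at z)"
    using Phol openA(1) zA by (rule holomorphic_derivI)
  then have "((\<lambda>x. of_real R / (P x - c)) has_field_derivative - (of_real R * deriv P z) / (P z - c)\<^sup>2) (at z)"
    using Pc[OF zA] by (auto intro!: derivative_eq_intros simp: power2_eq_square)
  then have "(q has_field_derivative - (of_real R * deriv P z) / (P z - c)\<^sup>2) (at z)"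
    by (rule has_field_derivative_transform_within_open[OF _ openA(1) zA]) (simp add: q1)
  then have dq: "cmod (deriv q z) = R / (cmod (w - c))\<^sup>2 * cmod (deriv P z)"
    using assms(3) by (simp add: DERIV_imp_deriv Pz norm_divide norm_mult norm_power)
  obtain T where T: "open T" "z \<in> T" "T \<subseteq> ?B" "inj_on p T"
    using covering_locally_injective[OF cov open_ball zB] by blast
  have "inj_on P (T \<inter> A)"
    using T(4) P by (metis Int_iff inj_on_def)
  moreover have "P holomorphic_on T \<inter> A" using Phol by (rule holomorphic_on_subset) auto
  ultimately have "deriv P z \<noteq> 0"
    using holomorphic_injective_imp_regular[of P "T \<inter> A" z] T openA(1) zA by auto
  then have dP: "cmod (deriv P z) > 0" by simp
  have z2: "1 - (cmod z)\<^sup>2 > 0" using z by (simp add: power_less_one_iff)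
  have q2: "1 - (cmod (q z))\<^sup>2 > 0" using qim zB by (auto simp: power_less_one_iff image_subset_iff)
  have "R / (cmod (w - c))\<^sup>2 * (cmod (deriv P z) * (1 - (cmod z)\<^sup>2)) \<le> 1 - (cmod (q z))\<^sup>2"
    using Schwarz_Pick[OF qhol qim zB] by (simp add: dq mult.assoc)
  then have "R / (cmod (w - c))\<^sup>2 / (1 - (cmod (q z))\<^sup>2) \<le> 1 / ((1 - (cmod z)\<^sup>2) * cmod (deriv P z))"
    using z2 q2 dP wc by (simp add: field_simps)
  then show "ennreal (R / (cmod (w - c))\<^sup>2 / (1 - (cmod (inversion c R (Fin w)))\<^sup>2)) \<le> x"
    unfolding x qz P_def by (rule ennreal_leI)
qed

text \<open>The inclusion of the disc into the sphere is one of its universal coverings.\<close>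

lemma hyperbolic_density_disc_le:
  assumes "cmod w < 1"
  shows "hyperbolic_density (Fin ` ball 0 1) w \<le> ennreal (1 / (1 - (cmod w)\<^sup>2))"
proof -
  let ?B = "ball 0 1 :: complex set"
  have id: "fin_coord \<circ> Fin = (\<lambda>z. z)" "recip_coord \<circ> Fin = (\<lambda>z. 1 / z)" by (auto simp: fun_eq_iff)
  have "homeomorphism ?B (Fin ` ?B) Fin fin_coord"
  proof (rule homeomorphismI)
    have "fin_coord -` W \<inter> Fin ` ?B = Fin ` (W \<inter> ?B)" for W by auto
    then show "continuous_on (Fin ` ?B) fin_coord"
      by (subst continuous_on_open_vimage) (auto intro!: open_Fin_image)
  qed (auto intro: Fin_continuous)
  then have "covering_space ?B Fin (Fin ` ?B)" by (rule homeomorphism_imp_covering_space)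
  then have "universal_covering Fin (Fin ` ?B)"
    unfolding universal_covering_def sphere_holomorphic_on_def id
    by (auto intro!: holomorphic_intros Fin_continuous)
  then show ?thesis
    unfolding hyperbolic_density_def using assms
    by (intro Inf_lower CollectI exI[of _ Fin] exI[of _ w]) (simp add: id)
qed

section \<open>Transfer of counterexamples from the disc to other domains\<close>

lemma ennreal_inverse_antimono:
  fixes b c :: ennreal
  shows "b \<le> c \<Longrightarrow> inverse c \<le> inverse b"
proof (cases "b = 0 \<or> c = top")
  case False
  moreover assume "b \<le> c"
  ultimately obtain x y where "b = ennreal x" "c = ennreal y" "0 < x" "x \<le> y"
    by (cases b rule: ennreal_cases; cases c rule: ennreal_cases)
      (auto simp: ennreal_le_iff2 order_less_le top_unique)
  then show ?thesis by (simp add: inverse_ennreal le_imp_inverse_le)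
qed auto

lemma divide_left_mono_ennreal:
  fixes a b c :: ennreal
  shows "b \<le> c \<Longrightarrow> a / c \<le> a / b"
  unfolding divide_ennreal_def by (intro mult_left_mono ennreal_inverse_antimono) auto

text \<open>Blow up a disc in the complement of \<open>\<Omega>\<close> about a fixed centre \<open>c\<close> until it touches the boundary of
  \<open>\<Omega>\<close>, at the radius \<open>R\<close> equal to the distance from \<open>c\<close> to \<open>\<Omega>\<close>, and invert. As \<open>\<Omega>\<close> is open, the
  distance is not attained, so the image is in the open unit disc; it comes arbitrarily close to the
  unit circle.\<close>

lemma exists_inversion_touching_circle:
  fixes \<Omega> :: "sphere set"
  assumes "sphere_domain \<Omega>" "\<exists>U. open U \<and> U \<noteq> {} \<and> U \<subseteq> - \<Omega>"
  obtains c R where "R > 0" "Fin c \<notin> \<Omega>" "\<And>p. p \<in> \<Omega> \<Longrightarrow> cmod (inversion c R p) < 1"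
    "\<And>\<eta>. \<eta> < 1 \<Longrightarrow> \<exists>p\<in>\<Omega>. \<eta> < cmod (inversion c R p)"
proof -
  have \<Omega>: "open \<Omega>" "\<Omega> \<noteq> {}" using assms(1) by (auto simp: sphere_domain_def)
  obtain U where U: "open U" "U \<noteq> {}" "U \<subseteq> - \<Omega>" using assms(2) by blast
  obtain c where c: "Fin c \<in> U" using open_sphere_contains_Fin[OF U(1,2)] .
  then have "c \<in> Fin -` U" by simp
  then obtain d where d: "d > 0" "ball c d \<subseteq> Fin -` U"
    using open_Fin_vimage[OF U(1)] openE by blast
  obtain z0 where z0: "Fin z0 \<in> \<Omega>" using open_sphere_contains_Fin[OF \<Omega>] .
  define S where "S = (\<lambda>z. cmod (z - c)) ` (Fin -` \<Omega>)"
  define R where "R = Inf S"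
  have S_ne: "S \<noteq> {}" using z0 by (auto simp: S_def)
  have S_ge: "d \<le> s" if "s \<in> S" for s
  proof (rule ccontr)
    assume "\<not> d \<le> s"
    with that obtain z where z: "Fin z \<in> \<Omega>" "cmod (z - c) < d" by (auto simp: S_def)
    then have "z \<in> ball c d" by (simp add: dist_norm norm_minus_commute)
    with d(2) U(3) z(1) show False by blast
  qed
  then have bdd: "bdd_below S" by (auto simp: bdd_below_def)
  have R: "R > 0" using cInf_greatest[OF S_ne S_ge] d(1) by (simp add: R_def)
  have c\<Omega>: "Fin c \<notin> \<Omega>" using c U(3) by blast
  have gt: "R < cmod (z - c)" if z: "Fin z \<in> \<Omega>" for z
  proof -
    have le: "R \<le> cmod (x - c)" if "Fin x \<in> \<Omega>" for x
      unfolding R_def using bdd that by (intro cInf_lower) (auto simp: S_def)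
    have zc: "z \<noteq> c" using z c\<Omega> by auto
    have "z \<in> Fin -` \<Omega>" using z by simp
    then obtain e where e: "e > 0" "ball z e \<subseteq> Fin -` \<Omega>"
      using open_Fin_vimage[OF \<Omega>(1)] openE by blast
    define t where "t = min (1 / 2) (e / (2 * cmod (z - c)))"
    have t: "0 < t" "t < 1" using e(1) zc by (auto simp: t_def)
    define x where "x = z - of_real t * (z - c)"
    have "dist z x = t * cmod (z - c)" using t by (simp add: x_def dist_norm norm_mult)
    also have "\<dots> \<le> e / (2 * cmod (z - c)) * cmod (z - c)"
      by (rule mult_right_mono) (auto simp: t_def)
    also have "\<dots> < e" using e(1) zc by simp
    finally have "Fin x \<in> \<Omega>" using e(2) by auto
    from le[OF this] have "R \<le> cmod (x - c)" .
    also have "x - c = of_real (1 - t) * (z - c)" by (simp add: x_def algebra_simps)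
    also have "cmod (of_real (1 - t) * (z - c)) = (1 - t) * cmod (z - c)"
      using t by (simp only: norm_mult norm_of_real)
    also have "\<dots> < 1 * cmod (z - c)" by (rule mult_strict_right_mono) (use t zc in auto)
    finally show ?thesis by simp
  qed
  have lt: "cmod (inversion c R p) < 1" if "p \<in> \<Omega>" for p
  proof (cases p)
    case (Fin z)
    then have "R < cmod (z - c)" using gt that by simp
    then show ?thesis using Fin R by (simp add: norm_divide divide_less_eq)
  qed simp
  have close: "\<exists>p\<in>\<Omega>. \<eta> < cmod (inversion c R p)" if "\<eta> < 1" for \<eta>
  proof -
    define \<eta>' where "\<eta>' = max \<eta> (1 / 2)"
    have \<eta>': "\<eta> \<le> \<eta>'" "0 < \<eta>'" "\<eta>' < 1" using that by (auto simp: \<eta>'_def)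
    have "R < R / \<eta>'" using R \<eta>' by (simp add: field_simps)
    then obtain s where "s \<in> S" "s < R / \<eta>'"
      using cInf_lessD[OF S_ne, of "R / \<eta>'"] by (auto simp: R_def)
    then obtain z where z: "Fin z \<in> \<Omega>" "cmod (z - c) < R / \<eta>'" by (auto simp: S_def)
    have "cmod (z - c) > 0" using gt[OF z(1)] R by linarith
    then have "\<eta>' < R / cmod (z - c)" using z(2) \<eta>' by (simp add: field_simps)
    then have "\<eta> < cmod (inversion c R (Fin z))" using \<eta>'(1) R by (simp add: norm_divide)
    with z(1) show ?thesis by blast
  qed
  show thesis by (rule that[OF R c\<Omega> lt close])
qed

text \<open>A connected set that reaches up to the unit circle has infinite hyperbolic diameter, so the
  intermediate value theorem provides every distance from a fixed point \<open>\<alpha>\<close>. The modulus of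
  \<open>Moebius_function 0 \<alpha> \<beta>\<close> is the pseudohyperbolic distance of \<open>\<alpha>\<close> and \<open>\<beta>\<close>.\<close>

lemma pseudohyperbolic_distance_attained:
  assumes "connected S" "S \<subseteq> ball 0 1" "\<And>\<eta>. \<eta> < 1 \<Longrightarrow> \<exists>\<beta>\<in>S. \<eta> < cmod \<beta>" "0 \<le> d" "d < 1"
  obtains \<alpha> \<beta> where "\<alpha> \<in> S" "\<beta> \<in> S" "cmod (Moebius_function 0 \<alpha> \<beta>) = d"
proof -
  obtain \<alpha> where \<alpha>: "\<alpha> \<in> S" using assms(3)[of 0] by auto
  have n\<alpha>: "cmod \<alpha> < 1" "cmod (- \<alpha>) < 1" using \<alpha> assms(2) by auto
  define h where "h = (\<lambda>\<beta>. cmod (Moebius_function 0 \<alpha> \<beta>))"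
  \<comment> \<open>The pseudohyperbolic disc of radius \<open>d\<close> about \<open>\<alpha>\<close> is compact in the unit disc, so a point of \<open>S\<close>
    close enough to the unit circle lies outside of it.\<close>
  have sub: "cball 0 d \<subseteq> ball (0::complex) 1" using assms(5) by auto
  have "continuous_on (cball 0 d) (\<lambda>x. cmod (Moebius_function 0 (- \<alpha>) x))"
    using continuous_on_subset[OF holomorphic_on_imp_continuous_on[OF Moebius_function_holomorphic[OF n\<alpha>(2)]] sub]
    by (rule continuous_on_norm)
  then obtain x where x: "x \<in> cball 0 d"
    "\<And>y. y \<in> cball 0 d \<Longrightarrow> cmod (Moebius_function 0 (- \<alpha>) y) \<le> cmod (Moebius_function 0 (- \<alpha>) x)"
    using continuous_attains_sup[of "cball (0::complex) d"] assms(4) by (metis ball_eq_empty cball_eq_empty compact_cball leD)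
  have "cmod (Moebius_function 0 (- \<alpha>) x) < 1"
    using Moebius_function_norm_lt_1[OF n\<alpha>(2), of x] x(1) sub by auto
  then obtain \<beta> where \<beta>: "\<beta> \<in> S" "cmod (Moebius_function 0 (- \<alpha>) x) < cmod \<beta>"
    using assms(3) by blast
  have "d < h \<beta>"
  proof (rule ccontr)
    assume "\<not> d < h \<beta>"
    then have "Moebius_function 0 \<alpha> \<beta> \<in> cball 0 d" by (simp add: h_def)
    from x(2)[OF this] have "cmod \<beta> \<le> cmod (Moebius_function 0 (- \<alpha>) x)"
      using Moebius_function_compose[of "- \<alpha>" \<alpha> \<beta>] n\<alpha> \<beta>(1) assms(2) by auto
    with \<beta>(2) show False by simp
  qed
  have "continuous_on S h"
    unfolding h_def
    using continuous_on_subset[OF holomorphic_on_imp_continuous_on[OF Moebius_function_holomorphic[OF n\<alpha>(1)]] assms(2)]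
    by (rule continuous_on_norm)
  then have "connected (h ` S)" using assms(1) by (rule connected_continuous_image)
  moreover have "h \<alpha> = 0" by (simp add: h_def Moebius_function_eq_zero)
  ultimately have "{0..h \<beta>} \<subseteq> h ` S"
    using connected_contains_Icc[of "h ` S" 0 "h \<beta>"] \<alpha> \<beta>(1) by (metis imageI)
  with \<open>d < h \<beta>\<close> assms(4) have "d \<in> h ` S" by auto
  with \<alpha> that show thesis by (auto simp: h_def)
qed

text \<open>Two pairs of points with the same pseudohyperbolic distance are related by an automorphism: move
  \<open>\<alpha>\<close> to the origin, rotate, and move the origin to \<open>z\<^sub>1\<close>.\<close>

lemma Moebius_move_pair:
  assumes "\<alpha> \<in> ball 0 1" "\<beta> \<in> ball 0 1" "z\<^sub>1 \<in> ball 0 1" "z\<^sub>2 \<in> ball 0 1"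
    and "cmod (Moebius_function 0 \<alpha> \<beta>) = cmod (Moebius_function 0 z\<^sub>1 z\<^sub>2)"
  obtains t where "Moebius_function 0 (- z\<^sub>1) (Moebius_function t \<alpha> \<alpha>) = z\<^sub>1"
    "Moebius_function 0 (- z\<^sub>1) (Moebius_function t \<alpha> \<beta>) = z\<^sub>2"
proof -
  define u where "u = Moebius_function 0 \<alpha> \<beta>"
  define v where "v = Moebius_function 0 z\<^sub>1 z\<^sub>2"
  have uv: "cmod u = cmod v" using assms(5) by (simp add: u_def v_def)
  obtain t where t: "exp (\<i> * of_real t) * u = v"
  proof (cases "u = 0")
    case True
    with uv that show thesis by auto
  next
    case False
    then have "cmod u \<noteq> 0" by simp
    then have "cmod (v / u) = 1" using uv by (simp only: norm_divide divide_self_if) simp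
    then obtain t where "v / u = exp (\<i> * of_real t)"
      by (metis complex_norm_eq_1_exp)
    with False that[of t] show thesis by (simp add: field_simps)
  qed
  have "Moebius_function t \<alpha> \<beta> = v"
    unfolding t[symmetric] u_def by (simp add: Moebius_function_def)
  then have "Moebius_function 0 (- z\<^sub>1) (Moebius_function t \<alpha> \<beta>) = z\<^sub>2"
    using Moebius_function_compose[of "- z\<^sub>1" z\<^sub>1 z\<^sub>2] assms(3,4) by (simp add: v_def)
  moreover have "Moebius_function 0 (- z\<^sub>1) (Moebius_function t \<alpha> \<alpha>) = z\<^sub>1"
    by (simp add: Moebius_function_eq_zero) (simp add: Moebius_function_def)
  ultimately show thesis using that by blast
qed

text \<open>For \<open>T\<close> the inversion in the plane, \<open>|S| = |S\<^sub>f (T z)| * |T' z|\<^sup>2\<close> while the density of \<open>\<Omega>\<close> is at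
  least \<open>|T' z|\<close> times the density of the disc at \<open>T z\<close>; restriction to a smaller domain can only
  decrease the Schwarzian norm.\<close>

lemma disc_counterexample_pullback:
  assumes f: "disc_counterexample c\<^sub>0 f z\<^sub>1 z\<^sub>2" and \<Omega>: "open \<Omega>"
    and R: "R > 0" and c: "Fin c \<notin> \<Omega>" and im: "\<And>p. p \<in> \<Omega> \<Longrightarrow> cmod (inversion c R p) < 1"
  shows "harmonic_mapping (\<lambda>p. f (inversion c R p)) \<Omega>"
    and "locally_univalent (\<lambda>p. f (inversion c R p)) \<Omega>"
    and "schwarzian_norm \<Omega> (\<lambda>p. f (inversion c R p)) \<le> ennreal c\<^sub>0"
proof -
  have fh: "harmonic_on f (ball 0 1)" "\<And>z. z \<in> ball 0 1 \<Longrightarrow> jacobian f z \<noteq> 0"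
    "\<And>z. z \<in> ball 0 1 \<Longrightarrow> cmod (schwarzian f z) * (1 - (cmod z)\<^sup>2)\<^sup>2 \<le> c\<^sub>0"
    using f by (auto simp: disc_counterexample_def)
  have ne: "z \<noteq> c" if "z \<in> Fin -` \<Omega>" for z using that c by auto
  have ne': "recip_chart \<zeta> \<noteq> Fin c" if "\<zeta> \<in> recip_chart -` \<Omega>" for \<zeta> using that c by auto
  define T where "T = (\<lambda>z. inversion c R (Fin z))"
  have Tim: "T ` (Fin -` \<Omega>) \<subseteq> ball 0 1" using im by (auto simp: T_def simp del: inversion.simps)
  have T: "T z = (0 * z + of_real R) / (1 * z + - c)" "1 * z + - c \<noteq> 0" if "z \<in> Fin -` \<Omega>" for z
    using ne[OF that] by (simp_all add: T_def)
  have det: "0 * - c - complex_of_real R * 1 \<noteq> 0" using R by simp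
  have T1: "harmonic_on (\<lambda>z. f (T z)) (Fin -` \<Omega>)"
    "\<And>z. z \<in> Fin -` \<Omega> \<Longrightarrow> schwarzian (\<lambda>z. f (T z)) z = schwarzian f (T z) * (deriv T z)\<^sup>2"
    using schwarzian_comp_mobius[OF open_Fin_vimage[OF \<Omega>] open_ball fh(1) _ _ _ det Tim] fh(2) T by blast+
  have dT: "cmod (deriv T z) = R / (cmod (z - c))\<^sup>2" if "z \<in> Fin -` \<Omega>" for z
  proof -
    have "deriv T z = (0 * - c - complex_of_real R * 1) / (1 * z + - c)\<^sup>2"
      using mobius_derivs(2)[OF open_Fin_vimage[OF \<Omega>] T(2) that T(1)] by blast
    then show ?thesis using R by (simp add: norm_divide norm_power)
  qed
  define T' where "T' = (\<lambda>\<zeta>. inversion c R (recip_chart \<zeta>))"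
  have T'im: "T' ` (recip_chart -` \<Omega>) \<subseteq> ball 0 1" using im by (auto simp: T'_def simp del: inversion.simps)
  have T': "T' \<zeta> = (of_real R * \<zeta> + 0) / (- c * \<zeta> + 1)" "- c * \<zeta> + 1 \<noteq> 0" if "\<zeta> \<in> recip_chart -` \<Omega>" for \<zeta>
    using inversion_recip_chart[OF ne'[OF that]] by (simp_all add: T'_def)
  have det': "complex_of_real R * 1 - 0 * - c \<noteq> 0" using R by simp
  have T2: "harmonic_on (\<lambda>z. f (T' z)) (recip_chart -` \<Omega>)"
    using schwarzian_comp_mobius(1)[OF open_recip_vimage[OF \<Omega>] open_ball fh(1) _ _ _ det' T'im] fh(2) T' by blast
  show "harmonic_mapping (\<lambda>p. f (inversion c R p)) \<Omega>"
    using T1(1) T2 by (simp add: harmonic_mapping_def o_def T_def T'_def del: inversion.simps)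
  show "locally_univalent (\<lambda>p. f (inversion c R p)) \<Omega>"
    unfolding locally_univalent_def
  proof
    fix p assume p: "p \<in> \<Omega>"
    obtain a b where form: "harmonic_form f a b (ball 0 1)"
      using harmonic_on_imp_harmonic_form[OF open_ball fh(1)] .
    have tp: "inversion c R p \<in> ball 0 1" using im[OF p] by simp
    obtain r where r: "r > 0" "ball (inversion c R p) r \<subseteq> ball 0 1" "inj_on f (ball (inversion c R p) r)"
      using harmonic_form_locally_injective[OF open_ball form tp fh(2)[OF tp]] .
    define V where "V = inversion c R -` ball (inversion c R p) r \<inter> \<Omega>"
    have "open V" unfolding V_def by (rule inversion_vimage_open[OF \<Omega> c open_ball])
    moreover have "p \<in> V" using r(1) p by (simp add: V_def)
    moreover have "inj_on (\<lambda>p. f (inversion c R p)) (V \<inter> \<Omega>)"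
    proof -
      have "inj_on (inversion c R) (V \<inter> \<Omega>)"
        using inversion_inj[of R c \<Omega>] R c by (auto intro: inj_on_subset)
      moreover have "inj_on f (inversion c R ` (V \<inter> \<Omega>))"
        using r(3) by (rule inj_on_subset) (auto simp: V_def)
      ultimately show ?thesis using comp_inj_on by (fastforce simp: o_def)
    qed
    ultimately show "\<exists>V. open V \<and> p \<in> V \<and> inj_on (\<lambda>p. f (inversion c R p)) (V \<inter> \<Omega>)" by blast
  qed
  show "schwarzian_norm \<Omega> (\<lambda>p. f (inversion c R p)) \<le> ennreal c\<^sub>0"
    unfolding schwarzian_norm_def
  proof (rule SUP_least)
    fix z assume z: "z \<in> Fin -` \<Omega>"
    define x where "x = R / (cmod (z - c))\<^sup>2 / (1 - (cmod (T z))\<^sup>2)"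
    have Tz: "T z \<in> ball 0 1" using Tim z by blast
    then have pos: "1 - (cmod (T z))\<^sup>2 > 0" by (simp add: power_less_one_iff)
    have x0: "x > 0" using pos R ne[OF z] by (simp add: x_def)
    have le: "ennreal x \<le> hyperbolic_density \<Omega> z"
      unfolding x_def T_def by (rule hyperbolic_density_ge[OF c im R]) (use z in auto)
    have "cmod (schwarzian f (T z) * (deriv T z)\<^sup>2) \<le> c\<^sub>0 * x\<^sup>2"
    proof -
      have "cmod (schwarzian f (T z)) \<le> c\<^sub>0 / (1 - (cmod (T z))\<^sup>2)\<^sup>2"
        using fh(3)[OF Tz] pos by (simp add: field_simps)
      then have "cmod (schwarzian f (T z)) * (cmod (deriv T z))\<^sup>2 \<le> c\<^sub>0 / (1 - (cmod (T z))\<^sup>2)\<^sup>2 * (cmod (deriv T z))\<^sup>2"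
        by (rule mult_right_mono) simp
      then show ?thesis
        by (simp add: norm_mult norm_power dT[OF z] x_def power_divide power_mult_distrib mult.commute)
    qed
    then have S: "cmod (schwarzian ((\<lambda>p. f (inversion c R p)) \<circ> Fin) z) / x\<^sup>2 \<le> c\<^sub>0"
      using x0 T1(2)[OF z] by (simp add: o_def T_def field_simps del: inversion.simps)
    have "ennreal (cmod (schwarzian ((\<lambda>p. f (inversion c R p)) \<circ> Fin) z)) / (hyperbolic_density \<Omega> z)\<^sup>2
        \<le> ennreal (cmod (schwarzian ((\<lambda>p. f (inversion c R p)) \<circ> Fin) z)) / (ennreal x)\<^sup>2"
      using le by (intro divide_left_mono_ennreal power_mono) auto
    also have "\<dots> = ennreal (cmod (schwarzian ((\<lambda>p. f (inversion c R p)) \<circ> Fin) z) / x\<^sup>2)"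
      using x0 by (simp add: ennreal_power divide_ennreal)
    also have "\<dots> \<le> ennreal c\<^sub>0" using S by (rule ennreal_leI)
    finally show "ennreal (cmod (schwarzian ((\<lambda>p. f (inversion c R p)) \<circ> Fin) z)) / (hyperbolic_density \<Omega> z)\<^sup>2
        \<le> ennreal c\<^sub>0" .
  qed
qed

text \<open>The pullback is noninjective as soon as the two points with the same image are in the image of
  \<open>\<Omega>\<close> under the inversion. An automorphism of the disc moves them there, because that image contains
  two points at the right hyperbolic distance.\<close>

lemma disc_counterexample_transfer:
  assumes "disc_counterexample c\<^sub>0 f z\<^sub>1 z\<^sub>2"
    and "sphere_domain \<Omega>" "\<exists>U. open U \<and> U \<noteq> {} \<and> U \<subseteq> - \<Omega>"
  obtains g where "harmonic_mapping g \<Omega>" "locally_univalent g \<Omega>" "schwarzian_norm \<Omega> g \<le> ennreal c\<^sub>0"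
    "\<not> inj_on g \<Omega>"
proof -
  obtain c R where cR: "R > 0" "Fin c \<notin> \<Omega>" "\<And>p. p \<in> \<Omega> \<Longrightarrow> cmod (inversion c R p) < 1"
    "\<And>\<eta>. \<eta> < 1 \<Longrightarrow> \<exists>p\<in>\<Omega>. \<eta> < cmod (inversion c R p)"
    by (rule exists_inversion_touching_circle[OF assms(2,3)], rule that; assumption?)
  have \<Omega>: "open \<Omega>" "connected \<Omega>" using assms(2) by (auto simp: sphere_domain_def)
  have z: "z\<^sub>1 \<in> ball 0 1" "z\<^sub>2 \<in> ball 0 1" using assms(1) by (auto simp: disc_counterexample_def)
  define S where "S = inversion c R ` \<Omega>"
  have S1: "connected S" unfolding S_def
    by (rule connected_continuous_image[OF inversion_continuous[OF \<Omega>(1) cR(2)] \<Omega>(2)])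
  have S2: "S \<subseteq> ball 0 1" using cR(3) by (auto simp: S_def)
  have S3: "\<exists>\<beta>\<in>S. \<eta> < cmod \<beta>" if "\<eta> < 1" for \<eta> using cR(4)[OF that] by (auto simp: S_def)
  have d1: "cmod (Moebius_function 0 z\<^sub>1 z\<^sub>2) < 1"
    using Moebius_function_norm_lt_1 z by simp
  obtain \<alpha> \<beta> where \<alpha>\<beta>: "\<alpha> \<in> S" "\<beta> \<in> S" "cmod (Moebius_function 0 \<alpha> \<beta>) = cmod (Moebius_function 0 z\<^sub>1 z\<^sub>2)"
    by (rule pseudohyperbolic_distance_attained[OF S1 S2 S3 norm_ge_zero d1])
  have \<alpha>: "\<alpha> \<in> ball 0 1" "\<beta> \<in> ball 0 1" using \<alpha>\<beta> S2 by auto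
  obtain t where t: "Moebius_function 0 (- z\<^sub>1) (Moebius_function t \<alpha> \<alpha>) = z\<^sub>1"
    "Moebius_function 0 (- z\<^sub>1) (Moebius_function t \<alpha> \<beta>) = z\<^sub>2"
    using Moebius_move_pair[OF \<alpha> z \<alpha>\<beta>(3)] .
  have M: "Moebius_function t \<alpha> x \<in> ball 0 1" if "x \<in> ball 0 1" for x
    using Moebius_function_norm_lt_1 \<alpha>(1) that by simp
  have "disc_counterexample c\<^sub>0 (\<lambda>z. f (Moebius_function 0 (- z\<^sub>1) z)) (Moebius_function t \<alpha> \<alpha>) (Moebius_function t \<alpha> \<beta>)"
    using assms(1) z(1) M[OF \<alpha>(1)] M[OF \<alpha>(2)] by (intro disc_counterexample_Moebius) (simp_all add: t)
  then have ex: "disc_counterexample c\<^sub>0 (\<lambda>z. f (Moebius_function 0 (- z\<^sub>1) (Moebius_function t \<alpha> z))) \<alpha> \<beta>"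
    by (rule disc_counterexample_Moebius) (use \<alpha> in auto)
  define h where "h = (\<lambda>z. f (Moebius_function 0 (- z\<^sub>1) (Moebius_function t \<alpha> z)))"
  obtain p q where pq: "p \<in> \<Omega>" "\<alpha> = inversion c R p" "q \<in> \<Omega>" "\<beta> = inversion c R q"
    using \<alpha>\<beta> by (auto simp: S_def)
  have "\<alpha> \<noteq> \<beta>" "h \<alpha> = h \<beta>" using ex by (auto simp: disc_counterexample_def h_def)
  then have noninj: "\<not> inj_on (\<lambda>p. h (inversion c R p)) \<Omega>"
    using pq by (auto simp: inj_on_def)
  show thesis
    by (rule that[OF _ _ _ noninj]; rule disc_counterexample_pullback[OF ex[folded h_def] \<Omega>(1) cR(1,2)])
      (rule cR(3), assumption)+
qed

text \<open>Lewy's theorem turns local univalence into nonvanishing of the Jacobian.\<close>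

lemma disc_noninjective_imp_counterexample:
  assumes "harmonic_mapping f (Fin ` ball 0 1)" "locally_univalent f (Fin ` ball 0 1)"
    and "schwarzian_norm (Fin ` ball 0 1) f \<le> ennreal c" "0 \<le> c" "\<not> inj_on f (Fin ` ball 0 1)"
  obtains z\<^sub>1 z\<^sub>2 where "disc_counterexample c (f \<circ> Fin) z\<^sub>1 z\<^sub>2"
proof -
  let ?B = "ball 0 1 :: complex set"
  have v: "Fin -` Fin ` ?B = ?B" by auto
  have harm: "harmonic_on (f \<circ> Fin) ?B" using assms(1) unfolding harmonic_mapping_def v by blast
  obtain a b where form: "harmonic_form (f \<circ> Fin) a b ?B"
    using harmonic_on_imp_harmonic_form[OF open_ball harm] .
  have J: "jacobian (f \<circ> Fin) z \<noteq> 0" if z: "z \<in> ?B" for z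
  proof -
    obtain V where V: "open V" "Fin z \<in> V" "inj_on f (V \<inter> Fin ` ?B)"
      using assms(2) z unfolding locally_univalent_def by blast
    define U where "U = Fin -` V \<inter> ?B"
    have "open U" unfolding U_def using open_Fin_vimage[OF V(1)] by auto
    moreover have "harmonic_form (f \<circ> Fin) a b U"
      using form unfolding harmonic_form_def U_def by (auto intro: holomorphic_on_subset)
    moreover have "z \<in> U" using V(2) z by (simp add: U_def)
    moreover have "inj_on (f \<circ> Fin) U"
      using V(3) by (force simp: inj_on_def U_def)
    ultimately show ?thesis by (rule Lewy)
  qed
  have S: "cmod (schwarzian (f \<circ> Fin) z) * (1 - (cmod z)\<^sup>2)\<^sup>2 \<le> c" if z: "z \<in> ?B" for z
  proof -
    define x where "x = 1 / (1 - (cmod z)\<^sup>2)"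
    have pos: "1 - (cmod z)\<^sup>2 > 0" using z by (simp add: power_less_one_iff)
    have x: "x > 0" using pos by (simp add: x_def)
    have "hyperbolic_density (Fin ` ?B) z \<le> ennreal x"
      unfolding x_def using hyperbolic_density_disc_le z by simp
    then have "ennreal (cmod (schwarzian (f \<circ> Fin) z)) / (ennreal x)\<^sup>2
       \<le> ennreal (cmod (schwarzian (f \<circ> Fin) z)) / (hyperbolic_density (Fin ` ?B) z)\<^sup>2"
      by (intro divide_left_mono_ennreal power_mono) auto
    also have "\<dots> \<le> schwarzian_norm (Fin ` ?B) f"
      unfolding schwarzian_norm_def by (rule SUP_upper) (use z in auto)
    also have "\<dots> \<le> ennreal c" by (rule assms(3))
    finally have "ennreal (cmod (schwarzian (f \<circ> Fin) z) / x\<^sup>2) \<le> ennreal c"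
      using x by (simp add: ennreal_power divide_ennreal)
    then have "cmod (schwarzian (f \<circ> Fin) z) / x\<^sup>2 \<le> c" using assms(4) by (simp add: ennreal_le_iff)
    then show ?thesis by (simp add: x_def power_divide)
  qed
  obtain z\<^sub>1 z\<^sub>2 where "z\<^sub>1 \<in> ?B" "z\<^sub>2 \<in> ?B" "z\<^sub>1 \<noteq> z\<^sub>2" "f (Fin z\<^sub>1) = f (Fin z\<^sub>2)"
    using assms(5) by (auto simp: inj_on_def)
  with harm J S that show thesis by (simp add: disc_counterexample_def)
qed

text \<open>The Cayley map \<open>T\<close> of the disc onto the right half-plane satisfies
  \<open>|T' z| * (1 - |z|\<^sup>2) = 2 * Re (T z)\<close>, which converts the bound for \<^const>\<open>wedge_map\<close>.\<close>

lemma wedge_map_disc_counterexample: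
  fixes m :: real
  assumes "m > 0"
  obtains f z\<^sub>1 z\<^sub>2 where "disc_counterexample (3 / 2 + 6 * m + 2 * m\<^sup>2) f z\<^sub>1 z\<^sub>2"
proof -
  let ?H = "{s::complex. Re s > 0}"
  let ?c = "3 / 2 + 6 * m + 2 * m\<^sup>2"
  define T where "T = (\<lambda>z::complex. (1 * z + 1) / (- 1 * z + 1))"
  have nz: "- 1 * z + 1 \<noteq> 0" if "z \<in> ball 0 1" for z :: complex using that by auto
  have det: "1 * 1 - 1 * - 1 \<noteq> (0::complex)" by simp
  have ReT: "Re (T z) = (1 - (cmod z)\<^sup>2) / (cmod (1 - z))\<^sup>2" for z
    unfolding T_def cmod_power2 by (simp add: Re_divide power2_eq_square algebra_simps)
  have im: "T ` ball 0 1 \<subseteq> ?H"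
  proof (rule image_subsetI, simp)
    fix z :: complex assume "cmod z < 1"
    then have "1 - (cmod z)\<^sup>2 > 0" "cmod (1 - z) > 0" by (auto simp: power_less_one_iff)
    then show "0 < Re (T z)" unfolding ReT by (intro divide_pos_pos) auto
  qed
  have m0: "m \<ge> 0" using assms by simp
  have T: "T w = (1 * w + 1) / (- 1 * w + 1)" for w by (simp add: T_def)
  note W = wedge_map_facts[OF m0]
  have comp: "harmonic_on (\<lambda>z. wedge_map m (T z)) (ball 0 1)"
    "\<And>z. z \<in> ball 0 1 \<Longrightarrow> jacobian (\<lambda>z. wedge_map m (T z)) z \<noteq> 0"
    "\<And>z. z \<in> ball 0 1 \<Longrightarrow> schwarzian (\<lambda>z. wedge_map m (T z)) z = schwarzian (wedge_map m) (T z) * (deriv T z)\<^sup>2"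
    using schwarzian_comp_mobius[OF open_ball open_halfspace_Re_gt W(1) _ _ _ det im] W(2) T nz by blast+
  have S: "cmod (schwarzian (\<lambda>z. wedge_map m (T z)) z) * (1 - (cmod z)\<^sup>2)\<^sup>2 \<le> ?c" if z: "z \<in> ball 0 1" for z
  proof -
    have z1: "cmod (1 - z) \<noteq> 0" using z by auto
    have "deriv T z = (1 * 1 - 1 * - 1) / (- 1 * z + 1)\<^sup>2"
      using mobius_derivs(2)[OF open_ball nz z T] by blast
    then have "cmod (deriv T z) = 2 / (cmod (1 - z))\<^sup>2" by (simp add: norm_divide norm_power add.commute)
    then have "cmod (deriv T z) * (1 - (cmod z)\<^sup>2) = 2 * Re (T z)" by (simp add: ReT)
    then have "(cmod (deriv T z))\<^sup>2 * (1 - (cmod z)\<^sup>2)\<^sup>2 = (2 * Re (T z))\<^sup>2"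
      by (simp flip: power_mult_distrib)
    then have "cmod (schwarzian (\<lambda>z. wedge_map m (T z)) z) * (1 - (cmod z)\<^sup>2)\<^sup>2
        = cmod (schwarzian (wedge_map m) (T z)) * (2 * Re (T z))\<^sup>2"
      by (simp add: comp(3)[OF z] norm_mult norm_power mult.assoc)
    also have "\<dots> \<le> ?c" using W(3) im z by blast
    finally show ?thesis .
  qed
  have inv: "\<exists>z\<in>ball 0 1. T z = s" if "Re s > 0" for s
  proof -
    have s1: "s + 1 \<noteq> 0" using that by (auto simp: complex_eq_iff)
    define z where "z = (s - 1) / (s + 1)"
    have "(cmod (s - 1))\<^sup>2 < (cmod (s + 1))\<^sup>2"
      unfolding cmod_power2 using that by (simp add: power2_eq_square algebra_simps)
    then have "cmod (s - 1) < cmod (s + 1)" by (rule power_less_imp_less_base) simp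
    then have "z \<in> ball 0 1" using s1 by (simp add: z_def norm_divide)
    moreover have "T z = s"
    proof -
      have "1 * z + 1 = 2 * s / (s + 1)" "- 1 * z + 1 = 2 / (s + 1)"
        using s1 by (simp_all add: z_def field_simps)
      then show ?thesis unfolding T_def using s1 by simp
    qed
    ultimately show ?thesis by blast
  qed
  note N = wedge_map_not_injective[OF assms]
  obtain z\<^sub>1 z\<^sub>2 where z: "z\<^sub>1 \<in> ball 0 1" "T z\<^sub>1 = cis (pi / (2 + m))"
    "z\<^sub>2 \<in> ball 0 1" "T z\<^sub>2 = cis (- (pi / (2 + m)))"
    using inv[OF N(1)] inv[OF N(2)] by blast
  then have "z\<^sub>1 \<noteq> z\<^sub>2" "wedge_map m (T z\<^sub>1) = wedge_map m (T z\<^sub>2)" using N(3,4) by auto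
  with comp(1,2) S z(1,3) have "disc_counterexample ?c (\<lambda>z. wedge_map m (T z)) z\<^sub>1 z\<^sub>2"
    unfolding disc_counterexample_def by blast
  then show thesis by (rule that)
qed

section \<open>Comparison of the inner radii\<close>

lemma disc_sphere_domain: "sphere_domain (Fin ` ball 0 1)"
  unfolding sphere_domain_def
  by (auto intro!: open_Fin_image connected_continuous_image Fin_continuous)

lemma disc_omits_open: "\<exists>U. open U \<and> U \<noteq> {} \<and> U \<subseteq> - (Fin ` ball 0 1)"
proof (intro exI conjI)
  show "open (Fin ` ball 3 1)" by (rule open_Fin_image) simp
  show "Fin ` ball 3 1 \<noteq> {}" by simp
  have "ball 3 1 \<inter> ball (0::complex) 1 = {}" by (rule disjoint_ballI) (simp add: dist_norm)
  then show "Fin ` ball 3 1 \<subseteq> - (Fin ` ball 0 1)" by auto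
qed

theorem theorem1:
  fixes \<Omega> :: "sphere set"
  assumes "sphere_domain \<Omega>"
    and "\<exists>U. open U \<and> U \<noteq> {} \<and> U \<subseteq> - \<Omega>"
  shows "harmonic_inner_radius \<Omega> \<le> harmonic_inner_radius (Fin ` ball 0 1)
         \<and> harmonic_inner_radius (Fin ` ball 0 1) \<le> ennreal (3 / 2)"
proof
  let ?D = "Fin ` ball 0 1"
  define good where "good = (\<lambda>\<Omega> c. \<forall>f. harmonic_mapping f \<Omega> \<longrightarrow> locally_univalent f \<Omega> \<longrightarrow>
                 schwarzian_norm \<Omega> f \<le> ennreal c \<longrightarrow> inj_on f \<Omega>)"
  have radius: "harmonic_inner_radius \<Omega> = Sup {ennreal c | c. 0 \<le> c \<and> good \<Omega> c}" for \<Omega>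
    by (simp add: harmonic_inner_radius_def good_def)
  have "good ?D c" if c: "good \<Omega> c" "0 \<le> c" for c
  proof (rule ccontr)
    assume "\<not> good ?D c"
    then obtain f where f: "harmonic_mapping f ?D" "locally_univalent f ?D"
      "schwarzian_norm ?D f \<le> ennreal c" "\<not> inj_on f ?D" by (auto simp: good_def)
    obtain z\<^sub>1 z\<^sub>2 where "disc_counterexample c (f \<circ> Fin) z\<^sub>1 z\<^sub>2"
      using disc_noninjective_imp_counterexample[OF f(1-3) c(2) f(4)] .
    then obtain g where "harmonic_mapping g \<Omega>" "locally_univalent g \<Omega>"
      "schwarzian_norm \<Omega> g \<le> ennreal c" "\<not> inj_on g \<Omega>"
      using disc_counterexample_transfer[OF _ assms] by blast
    with c(1) show False by (auto simp: good_def)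
  qed
  then show "harmonic_inner_radius \<Omega> \<le> harmonic_inner_radius ?D"
    unfolding radius by (intro Sup_subset_mono) blast
  show "harmonic_inner_radius ?D \<le> ennreal (3 / 2)"
    unfolding radius
  proof (rule Sup_least, elim CollectE exE conjE)
    fix x c assume x: "x = ennreal c" and c: "0 \<le> c" "good ?D c"
    have "c \<le> 3 / 2"
    proof (rule ccontr)
      assume "\<not> c \<le> 3 / 2"
      \<comment> \<open>For \<open>m \<le> 1\<close> the excess \<open>6 * m + 2 * m\<^sup>2\<close> of the Schwarzian norm is at most \<open>8 * m\<close>.\<close>
      define m where "m = min 1 ((c - 3 / 2) / 8)"
      have m: "0 < m" "m \<le> 1" "8 * m \<le> c - 3 / 2"
        using \<open>\<not> c \<le> 3 / 2\<close> min.cobounded2[of 1 "(c - 3 / 2) / 8"] unfolding m_def by auto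
      have "m\<^sup>2 \<le> m" using m by (simp add: power2_eq_square mult_left_le)
      then have le: "3 / 2 + 6 * m + 2 * m\<^sup>2 \<le> c" using m(3) by linarith
      obtain f z\<^sub>1 z\<^sub>2 where "disc_counterexample (3 / 2 + 6 * m + 2 * m\<^sup>2) f z\<^sub>1 z\<^sub>2"
        using wedge_map_disc_counterexample[OF m(1)] .
      then obtain g where g: "harmonic_mapping g ?D" "locally_univalent g ?D"
        "schwarzian_norm ?D g \<le> ennreal (3 / 2 + 6 * m + 2 * m\<^sup>2)" "\<not> inj_on g ?D"
        using disc_counterexample_transfer[OF _ disc_sphere_domain disc_omits_open] by blast
      have "schwarzian_norm ?D g \<le> ennreal c" using g(3) ennreal_leI[OF le] by (rule order_trans)
      with g c(2) show False by (auto simp: good_def)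
    qed
    then show "x \<le> ennreal (3 / 2)" unfolding x by (rule ennreal_leI)
  qed
qed

end
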